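(* Let $G$ be an infinite planar group satisfying the ascending and descending chain conditions on subgroups. Then $G$ has no involutions (elements of order $2$).
   Context: For a group $G$, the subgroup graph $\mathcal{L}(G)$ is the graph whose vertices are all subgroups of $G$, two subgroups $H,K$ being adjacent if one of them is a maximal subgroup of the other. $G$ is planar if $\mathcal{L}(G)$ is a planar graph. *)

theory Defs
  imports "HOL-Analysis.Analysis" "HOL-Algebra.Algebra"
begin

definition maximal_subgroup_of :: "('a, 'b) monoid_scheme \<Rightarrow> 'a set \<Rightarrow> 'a set \<Rightarrow> bool" where
  "maximal_subgroup_of G H K \<longleftrightarrow> subgroup H G \<and> subgroup K G \<and> H \<subset> K \<and>
     (\<forall>L. subgroup L G \<and> H \<subseteq> L \<and> L \<subseteq> K \<longrightarrow> L = H \<or> L = K)"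

definition subgroup_graph_vertices :: "('a, 'b) monoid_scheme \<Rightarrow> 'a set set" where
  "subgroup_graph_vertices G = {H. subgroup H G}"

definition subgroup_graph_adj :: "('a, 'b) monoid_scheme \<Rightarrow> 'a set \<Rightarrow> 'a set \<Rightarrow> bool" where
  "subgroup_graph_adj G H K \<longleftrightarrow> maximal_subgroup_of G H K \<or> maximal_subgroup_of G K H"

definition planar_graph :: "'v set \<Rightarrow> ('v \<Rightarrow> 'v \<Rightarrow> bool) \<Rightarrow> bool" where
  "planar_graph V adj \<longleftrightarrow>
    (\<exists>(pos :: 'v \<Rightarrow> real \<times> real) (\<gamma> :: 'v \<Rightarrow> 'v \<Rightarrow> real \<Rightarrow> real \<times> real).
       inj_on pos V \<and>
       (\<forall>u\<in>V. \<forall>v\<in>V. adj u v \<longrightarrow>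
          arc (\<gamma> u v) \<and> pathstart (\<gamma> u v) = pos u \<and> pathfinish (\<gamma> u v) = pos v \<and>
          path_image (\<gamma> u v) \<inter> pos ` V = {pos u, pos v}) \<and>
       (\<forall>u\<in>V. \<forall>v\<in>V. \<forall>x\<in>V. \<forall>y\<in>V. adj u v \<and> adj x y \<and> {u, v} \<noteq> {x, y} \<longrightarrow>
          path_image (\<gamma> u v) \<inter> path_image (\<gamma> x y) \<subseteq> pos ` ({u, v} \<inter> {x, y})))"

definition planar_group :: "('a, 'b) monoid_scheme \<Rightarrow> bool" where
  "planar_group G \<longleftrightarrow> planar_graph (subgroup_graph_vertices G) (subgroup_graph_adj G)"

definition subgroup_acc :: "('a, 'b) monoid_scheme \<Rightarrow> bool" where
  "subgroup_acc G \<longleftrightarrow> \<not> (\<exists>f :: nat \<Rightarrow> 'a set. (\<forall>n. subgroup (f n) G) \<and> (\<forall>n. f n \<subset> f (Suc n)))"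

definition subgroup_dcc :: "('a, 'b) monoid_scheme \<Rightarrow> bool" where
  "subgroup_dcc G \<longleftrightarrow> \<not> (\<exists>f :: nat \<Rightarrow> 'a set. (\<forall>n. subgroup (f n) G) \<and> (\<forall>n. f (Suc n) \<subset> f n))"

end

theory Submission
  imports Defs
begin

text \<open>
  If \<open>E\<close> is a subgroup with three covers, each having a subgroup incomparable with \<open>E\<close>, then \<open>E\<close>,
  the subgroups above the covers and the subgroups below them not containing \<open>E\<close> form a \<open>K\<^sub>3\<^sub>,\<^sub>3\<close>
  minor together with the three covers. By the chain conditions any infinite family of subgroups
  containing \<open>E\<^sub>0\<close> yields an \<open>E \<supseteq> E\<^sub>0\<close> with infinitely many covers inside members of the family.

  The group is periodic by the descending chain condition. Applied to dihedral groups, the above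
  shows that for a finite subgroup \<open>Z\<close> with normalizer \<open>N\<close> there are only finitely many involutions in
  \<open>N/Z\<close>. If \<open>N\<close> is infinite, the centralizer of such an involution is infinite too, so \<open>Z\<close> can be
  enlarged. Starting from an involution of \<open>G\<close> and using the ascending chain condition, one reaches
  a finite \<open>Z\<close> of even order with infinite normalizer \<open>N\<close> such that \<open>N/Z\<close> has no involutions. Then the
  groups \<open>Z\<langle>y\<rangle>\<close> for \<open>y \<in> N\<close> are again a forbidden family, their new elements having odd-order powers.
\<close>

section \<open>Nonplanarity of \<open>K\<^sub>3\<^sub>,\<^sub>3\<close>\<close>

text \<open>By the Jordan curve theorem every point of the curve lies in the closure of both sides,
  so \<open>U\<close> contains points of both; \<open>r\<close> cannot be connected to both of
  them.\<close>

lemma arcs_Jordan_other_side: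
  fixes A B :: "real \<Rightarrow> complex"
  assumes "arc A" "arc B" "pathstart A = p" "pathfinish A = q" "pathstart B = p" "pathfinish B = q"
    and AB: "path_image A \<inter> path_image B = {p, q}"
    and a: "a \<in> path_image A \<union> path_image B" and "open U" "a \<in> U"
  obtains x where "x \<in> U" "x \<notin> path_image A \<union> path_image B"
    "\<not> connected_component (- (path_image A \<union> path_image B)) r x"
proof -
  define c where "c = A +++ reversepath B"
  have sp: "simple_path c" and loop: "pathfinish c = pathstart c"
    unfolding c_def using assms by (auto intro!: simple_path_join_loop simp: arc_reversepath)
  have im: "path_image c = path_image A \<union> path_image B"
    unfolding c_def using assms by (simp add: path_image_join)
  obtain I O' where "I \<noteq> {}" "open I" "connected I" "O' \<noteq> {}" "open O'" "connected O'"
    "bounded I" "\<not> bounded O'" "I \<inter> O' = {}" "I \<union> O' = - path_image c"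
    "frontier I = path_image c" "frontier O' = path_image c"
    by (rule Jordan_curve[OF sp loop])
  note IO = this
  have "a \<in> closure I" "a \<in> closure O'"
    using a IO im by (auto simp: frontier_def)
  then obtain i j where ij: "i \<in> I" "i \<in> U" "j \<in> O'" "j \<in> U"
    using \<open>open U\<close> \<open>a \<in> U\<close> by (metis disjoint_iff open_Int_closure_eq_empty)
  have "\<not> connected_component (- path_image c) i j"
  proof
    assume "connected_component (- path_image c) i j"
    then obtain T where T: "connected T" "T \<subseteq> I \<union> O'" "i \<in> T" "j \<in> T"
      using IO by (auto simp: connected_component_def)
    then show False using connectedD[OF T(1) IO(2,5)] ij IO by blast
  qed
  then have "\<not> connected_component (- path_image c) r i \<or> \<not> connected_component (- path_image c) r j"
    by (meson connected_component_sym connected_component_trans)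
  moreover have "i \<notin> path_image c" "j \<notin> path_image c" using ij IO by blast+
  ultimately show thesis using that ij im by metis
qed

lemma connected_component_near:
  fixes S :: "'a::real_normed_vector set"
  assumes "connected_component S r a" "open S"
  obtains U where "open U" "a \<in> U" "\<And>x. x \<in> U \<Longrightarrow> connected_component S r x"
  by (rule that[of "connected_component_set S r"]) (use assms in \<open>auto simp: open_connected_component\<close>)

text \<open>
  Three arcs from \<open>p\<close> to \<open>q\<close> meet only at their ends. Such a theta curve has three complementary
  regions, each of which sees only two of the arcs; here \<open>r\<close> would see all three. Take \<open>x\<close> close
  to \<open>A\<close> on the other side of the Jordan curve \<open>A \<union> B\<close> from \<open>r\<close>. By Janiszewski's theorem \<open>A \<union> C\<close>
  separates \<open>x\<close> from \<open>r\<close> as well, so the component of \<open>x\<close> has its whole frontier in \<open>A\<close>; but an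
  arc does not separate the plane.
\<close>
lemma theta_accessible:
  fixes A B C :: "real \<Rightarrow> complex"
  assumes arcs: "arc A" "arc B" "arc C"
    and start: "pathstart A = p" "pathstart B = p" "pathstart C = p"
    and finish: "pathfinish A = q" "pathfinish B = q" "pathfinish C = q"
    and AB: "path_image A \<inter> path_image B = {p, q}"
    and AC: "path_image A \<inter> path_image C = {p, q}"
    and BC: "path_image B \<inter> path_image C = {p, q}"
    and r: "r \<notin> path_image A \<union> path_image B \<union> path_image C"
    and rA: "\<And>x. x \<in> path_image A - {p, q} \<Longrightarrow> connected_component (- (path_image B \<union> path_image C)) r x"
    and rB: "\<And>x. x \<in> path_image B - {p, q} \<Longrightarrow> connected_component (- (path_image A \<union> path_image C)) r x"
    and rC: "\<And>x. x \<in> path_image C - {p, q} \<Longrightarrow> connected_component (- (path_image A \<union> path_image B)) r x"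
  shows False
proof -
  let ?A = "path_image A" and ?B = "path_image B" and ?C = "path_image C"
  have cl: "closed ?A" "closed ?B" "closed ?C" and co: "compact ?A" "compact ?B" "compact ?C"
    using arcs by (auto simp: closed_arc_image compact_arc_image)
  have opens: "open (- (?A \<union> ?B))" "open (- (?A \<union> ?C))" "open (- (?B \<union> ?C))"
    using cl by (simp_all only: open_Compl closed_Un)
  have "?A - {p,q} \<noteq> {}"
    using nonempty_simple_path_endless[of A] arcs start finish arc_imp_simple_path by blast
  then obtain a where a: "a \<in> ?A - {p,q}" by blast
  obtain U where U: "open U" "a \<in> U" "\<And>x. x \<in> U \<Longrightarrow> connected_component (- (?B \<union> ?C)) r x"
    using connected_component_near[OF rA[OF a] opens(3)] by blast
  obtain x where x: "x \<in> U" "x \<notin> ?A \<union> ?B" "\<not> connected_component (- (?A \<union> ?B)) r x"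
    using arcs_Jordan_other_side[OF arcs(1,2) start(1) finish(1) start(2) finish(2) AB _ U(1,2)] a
    by (metis DiffD1 UnCI)
  have x\<theta>: "x \<in> - (?A \<union> ?B \<union> ?C)"
    using x U(3)[OF x(1)] connected_component_in by fastforce
  have notAC: "\<not> connected_component (- (?A \<union> ?C)) r x"
  proof
    assume rx: "connected_component (- (?A \<union> ?C)) r x"
    \<comment> \<open>The two closed sets meet exactly in the arc \<open>C\<close>; its
      connectedness is what Janiszewski's theorem asks for.\<close>
    have "(?B \<union> ?C) \<inter> (?A \<union> ?C) = ?C" using AB AC by blast
    then have "connected ((?B \<union> ?C) \<inter> (?A \<union> ?C))" using arcs by (simp add: connected_arc_image)
    then have "connected_component (- ((?B \<union> ?C) \<union> (?A \<union> ?C))) r x"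
      using Janiszewski[OF _ _ _ U(3)[OF x(1)] rx] by (simp only: compact_Un co closed_Un cl simp_thms)
    then have "connected_component (- (?A \<union> ?B)) r x"
      by (rule connected_component_of_subset) auto
    then show False using x by blast
  qed
  define W where "W = connected_component_set (- (?A \<union> ?B \<union> ?C)) x"
  have Wsub: "W \<subseteq> - (?A \<union> ?B \<union> ?C)" unfolding W_def by (rule connected_component_subset)
  have xW: "x \<in> W" using x\<theta> by (simp add: W_def)
  have frW: "frontier W \<subseteq> ?A \<union> ?B \<union> ?C"
    using frontier_of_connected_component_subset[of "- (?A \<union> ?B \<union> ?C)" x]
      frontier_subset_closed[of "?A \<union> ?B \<union> ?C"] cl unfolding W_def by (simp only: frontier_complement closed_Un) (blast intro: order_trans)
  \<comment> \<open>Every neighbourhood of a frontier point of \<open>W\<close> meets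
    \<open>W\<close>, so reaching such a point inside \<open>T\<close> means reaching
    \<open>x\<close> inside \<open>T\<close>.\<close>
  have touch: "connected_component T r x" if T: "open T" "- (?A \<union> ?B \<union> ?C) \<subseteq> T" "f \<in> frontier W" "connected_component T r f" for T f
  proof -
    obtain U where "open U" "f \<in> U" and U: "\<And>x. x \<in> U \<Longrightarrow> connected_component T r x"
      using connected_component_near T by metis
    moreover have "f \<in> closure W" using T by (simp add: frontier_def)
    ultimately obtain y where "y \<in> W" "y \<in> U" by (metis disjoint_iff open_Int_closure_eq_empty)
    then have "connected_component T r y" "connected_component T y x"
      using U T(2) unfolding W_def
      by (auto intro: connected_component_of_subset connected_component_sym)
    then show ?thesis by (rule connected_component_trans)
  qed
  have "frontier W \<subseteq> ?A"
  proof
    fix f assume f: "f \<in> frontier W"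
    have "f \<notin> ?C - {p,q}"
    proof
      assume "f \<in> ?C - {p,q}"
      from touch[OF opens(1) _ f rC[OF this]] x(3) show False by blast
    qed
    moreover have "f \<notin> ?B - {p,q}"
    proof
      assume "f \<in> ?B - {p,q}"
      from touch[OF opens(2) _ f rB[OF this]] notAC show False by blast
    qed
    ultimately show "f \<in> ?A" using f frW AB by auto
  qed
  moreover have "connected (- ?A)" using arcs by (simp add: connected_arc_complement)
  moreover have "r \<in> - ?A - W"
    using r x connected_component_of_subset[of "- (?A \<union> ?B \<union> ?C)" x r "- (?A \<union> ?B)"]
    unfolding W_def by (auto dest: connected_component_sym)
  \<comment> \<open>The connected complement of \<open>A\<close> contains \<open>x\<close> in
    \<open>W\<close> and \<open>r\<close> outside \<open>W\<close>, so it would meet the frontier of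
    \<open>W\<close>, which lies in \<open>A\<close>.\<close>
  ultimately show False
    using connected_Int_frontier[of "- ?A" W] xW Wsub by blast
qed


section \<open>Planar drawings and branch sets of a K(3,3) minor\<close>

text \<open>
  A connected vertex set \<open>S\<close> off \<open>M\<close> in which every vertex of \<open>M\<close> has a neighbour, that is, one of the
  branch sets of a \<open>K\<^sub>3\<^sub>,\<^sub>3\<close> minor whose opposite side consists of the three single vertices of \<open>M\<close>.
\<close>
definition attached_set :: "'v set \<Rightarrow> ('v \<Rightarrow> 'v \<Rightarrow> bool) \<Rightarrow> 'v set \<Rightarrow> 'v set \<Rightarrow> bool" where
  "attached_set V adj M S \<longleftrightarrow> S \<subseteq> V \<and> S \<inter> M = {} \<and> (\<forall>m\<in>M. \<exists>u\<in>S. adj u m) \<and>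
     (\<exists>u\<^sub>0\<in>S. \<forall>u\<in>S. (\<lambda>a b. a \<in> S \<and> b \<in> S \<and> adj a b)\<^sup>*\<^sup>* u u\<^sub>0)"

lemma subset_cover: "P \<inter> K \<subseteq> {w} \<Longrightarrow> P - K \<subseteq> A \<Longrightarrow> w \<in> B \<Longrightarrow> P \<subseteq> A \<union> B"
  by blast

text \<open>The stars of \<open>S1\<close>, \<open>S2\<close>, \<open>S3\<close> are disjoint and
  connected. Joining \<open>pos m1\<close> to \<open>pos m2\<close> through each of them gives a
  theta curve, and \<open>pos m3\<close> reaches each arc through that arc's own star, which avoids
  the other two arcs. This contradicts \<open>theta_accessible\<close>.\<close>

lemma no_K33_drawing:
  fixes pos :: "'v \<Rightarrow> complex" and \<gamma> :: "'v \<Rightarrow> 'v \<Rightarrow> real \<Rightarrow> complex"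
  assumes inj: "inj_on pos V"
    and edge: "\<And>u v. u \<in> V \<Longrightarrow> v \<in> V \<Longrightarrow> adj u v \<Longrightarrow>
          arc (\<gamma> u v) \<and> pathstart (\<gamma> u v) = pos u \<and> pathfinish (\<gamma> u v) = pos v \<and>
          path_image (\<gamma> u v) \<inter> pos ` V = {pos u, pos v}"
    and cross: "\<And>u v x y. u \<in> V \<Longrightarrow> v \<in> V \<Longrightarrow> x \<in> V \<Longrightarrow> y \<in> V \<Longrightarrow> adj u v \<Longrightarrow> adj x y \<Longrightarrow> {u, v} \<noteq> {x, y} \<Longrightarrow>
          path_image (\<gamma> u v) \<inter> path_image (\<gamma> x y) \<subseteq> pos ` ({u, v} \<inter> {x, y})"
    and m: "m1 \<in> V" "m2 \<in> V" "m3 \<in> V" "m1 \<noteq> m2" "m1 \<noteq> m3" "m2 \<noteq> m3"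
    and S: "attached_set V adj {m1, m2, m3} S1" "attached_set V adj {m1, m2, m3} S2"
      "attached_set V adj {m1, m2, m3} S3"
    and disj: "S1 \<inter> S2 = {}" "S1 \<inter> S3 = {}" "S2 \<inter> S3 = {}"
  shows False
proof -
  define M where "M = {m1, m2, m3}"
  have MV: "M \<subseteq> V" using m by (auto simp: M_def)
  have pos_eq: "pos u = pos v \<longleftrightarrow> u = v" if "u \<in> V" "v \<in> V" for u v
    using inj that by (auto simp: inj_on_def)
  \<comment> \<open>the part of the drawing spanned by \<open>S\<close> and its edges to \<open>M\<close>, without the points of \<open>M\<close>:
    disjoint \<open>S\<close> have disjoint stars even if the graph has edges between them\<close>
  define star where "star S = pos ` S \<union> (\<Union>u\<in>S. \<Union>v\<in>{v \<in> S \<union> M. adj u v}. path_image (\<gamma> u v) - pos ` M)" for S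
  \<comment> \<open>A vertex lies on no edge of which it is not an end, and edges from different
    stars can share only an end in \<open>M\<close>, which the stars omit.\<close>
  have star_disj: "star S \<inter> star S' = {}"
    if "S \<inter> S' = {}" "attached_set V adj M S" "attached_set V adj M S'" for S S'
  proof -
    have sub: "S \<subseteq> V" "S' \<subseteq> V" "S \<inter> M = {}" "S' \<inter> M = {}" using that by (auto simp: attached_set_def)
    have 1: "x \<notin> pos ` S \<inter> pos ` S'" for x using sub that(1) by (auto simp: pos_eq subset_iff)
    have 2: "pos s \<notin> path_image (\<gamma> u v)"
      if "s \<in> V" "u \<in> V" "v \<in> V" "adj u v" "s \<noteq> u" "s \<noteq> v" for s u v
      using edge[of u v] that pos_eq by blast
    have 3: "x \<in> pos ` M" if "u \<in> S" "v \<in> S \<union> M" "adj u v" "u' \<in> S'" "v' \<in> S' \<union> M" "adj u' v'"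
      "x \<in> path_image (\<gamma> u v)" "x \<in> path_image (\<gamma> u' v')" for x u v u' v'
    proof -
      have "u \<noteq> u'" "u \<noteq> v'" "v = v' \<Longrightarrow> v \<in> M" "v \<noteq> u'" using that(1,2,4,5) sub \<open>S \<inter> S' = {}\<close> by blast+
      then have "{u, v} \<noteq> {u', v'}" "{u, v} \<inter> {u', v'} \<subseteq> M" by auto
      moreover have "u \<in> V" "v \<in> V" "u' \<in> V" "v' \<in> V" using that sub MV by auto
      ultimately show ?thesis using cross[of u v u' v'] that by blast
    qed
    show ?thesis
    proof (rule ccontr)
      assume "star S \<inter> star S' \<noteq> {}"
      then obtain x where x: "x \<in> star S" "x \<in> star S'" by blast
      have e: "x \<notin> pos ` S'" if "u \<in> S" "v \<in> S \<union> M" "adj u v" "x \<in> path_image (\<gamma> u v)" for u v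
        using 2[of _ u v] that sub MV \<open>S \<inter> S' = {}\<close> by blast
      have e': "x \<notin> pos ` S" if "u \<in> S'" "v \<in> S' \<union> M" "adj u v" "x \<in> path_image (\<gamma> u v)" for u v
        using 2[of _ u v] that sub MV \<open>S \<inter> S' = {}\<close> by blast
      have split: "x \<in> pos ` S \<or> (\<exists>u\<in>S. \<exists>v\<in>S \<union> M. adj u v \<and> x \<in> path_image (\<gamma> u v) \<and> x \<notin> pos ` M)"
        if "x \<in> star S" for S using that unfolding star_def by blast
      show False
        using split[OF x(1)]
      proof
        assume "x \<in> pos ` S"
        then show False using split[OF x(2)] 1[of x] e' by blast
      next
        assume "\<exists>u\<in>S. \<exists>v\<in>S \<union> M. adj u v \<and> x \<in> path_image (\<gamma> u v) \<and> x \<notin> pos ` M"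
        then obtain u v where uv: "u \<in> S" "v \<in> S \<union> M" "adj u v" "x \<in> path_image (\<gamma> u v)" "x \<notin> pos ` M" by blast
        have "x \<notin> pos ` S'" using e uv by blast
        with split[OF x(2)] obtain u' v' where "u' \<in> S'" "v' \<in> S' \<union> M" "adj u' v'" "x \<in> path_image (\<gamma> u' v')"
          by blast
        then show False using 3[OF uv(1-3) _ _ _ uv(4)] uv(5) by blast
      qed
    qed
  qed
  have star_M: "star S \<inter> pos ` M = {}" if "attached_set V adj M S" for S
    using that MV pos_eq unfolding star_def attached_set_def by fast
  have star_conn: "path_connected (star S \<union> pos ` N)" if S: "attached_set V adj M S" and N: "N \<subseteq> M" for S N
  proof -
    let ?T = "star S \<union> pos ` N"
    have sub: "S \<subseteq> V" "S \<inter> M = {}" using S by (auto simp: attached_set_def)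
    have posM: "pos u \<notin> pos ` M" if "u \<in> S" for u using that sub MV pos_eq by blast
    have piece: "path_component ?T (pos u) x"
      if u: "u \<in> S" "v \<in> S \<union> M" "adj u v" and x: "x \<in> path_image (\<gamma> u v) - pos ` M" for u v x
    proof -
      have uv: "u \<in> V" "v \<in> V" using u sub MV by auto
      note e = edge[OF uv u(3)]
      from x obtain t where t: "0 \<le> t" "t \<le> 1" "x = \<gamma> u v t" by (auto simp: path_image_def)
      \<comment> \<open>The edge can meet the points of \<open>M\<close> only at parameter 1, so its
        initial piece up to \<open>x\<close>, which is itself off \<open>M\<close>, stays inside the
        star.\<close>
      have "\<gamma> u v s \<notin> pos ` M" if s: "0 \<le> s" "s \<le> t" for s
      proof
        assume sM: "\<gamma> u v s \<in> pos ` M"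
        have "\<gamma> u v s \<in> path_image (\<gamma> u v)" using s t by (auto simp: path_image_def)
        then have "\<gamma> u v s \<in> {pos u, pos v}" using e sM MV by blast
        then have "\<gamma> u v s = \<gamma> u v 1" using posM[OF u(1)] sM e by (auto simp: pathfinish_def)
        then have "s = 1" using e s t by (auto simp: arc_def inj_on_def)
        then have "t = 1" using s t by simp
        then show False using x t sM \<open>s = 1\<close> by simp
      qed
      then have "\<gamma> u v ` {0..t} \<subseteq> ?T"
        using u t unfolding star_def path_image_def by fastforce
      moreover have "path_connected (\<gamma> u v ` {0..t})"
        using e t by (intro path_connected_continuous_image convex_imp_path_connected)
          (auto simp: arc_def path_def intro: continuous_on_subset)
      moreover have "pos u \<in> \<gamma> u v ` {0..t}"
        using e t by (auto simp: pathstart_def image_iff intro!: bexI[of _ 0])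
      moreover have "x \<in> \<gamma> u v ` {0..t}" using t by auto
      ultimately show ?thesis
        by (meson path_component_of_subset path_connected_component)
    qed
    obtain u0 where u0: "u0 \<in> S" and reach: "\<And>u. u \<in> S \<Longrightarrow> (\<lambda>a b. a \<in> S \<and> b \<in> S \<and> adj a b)\<^sup>*\<^sup>* u u0"
      using S by (auto simp: attached_set_def)
    have vert: "path_component ?T (pos u) (pos u0)" if "u \<in> S" for u
      using reach[OF that]
    proof (induction rule: converse_rtranclp_induct)
      case base
      show ?case using u0 by (auto intro!: path_component_refl simp: star_def)
    next
      case (step a b)
      have "pos b \<in> path_image (\<gamma> a b)"
        using edge[of a b] step sub by (metis pathfinish_in_path_image subsetD)
      then have "path_component ?T (pos a) (pos b)" using step posM by (intro piece) auto
      then show ?case using step path_component_trans by blast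
    qed
    have "path_component ?T x (pos u0)" if x: "x \<in> ?T" for x
    proof -
      consider u where "u \<in> S" "x = pos u"
        | u v where "u \<in> S" "v \<in> S \<union> M" "adj u v" "x \<in> path_image (\<gamma> u v) - pos ` M"
        | w where "w \<in> N" "x = pos w"
        using x unfolding star_def Un_iff UN_iff image_iff mem_Collect_eq by blast
      then show ?thesis
      proof cases
        case 2 then show ?thesis using vert piece path_component_sym path_component_trans by blast
      next
        case (3 w)
        then obtain u where u: "u \<in> S" "adj u w" using S N unfolding attached_set_def by blast
        have uw: "u \<in> V" "w \<in> V" using u 3 sub N MV by auto
        note e = edge[OF uw u(2)]
        have "path_image (\<gamma> u w) \<inter> pos ` M \<subseteq> {pos u, pos w}" using e MV by auto
        then have "path_image (\<gamma> u w) \<inter> pos ` M \<subseteq> {pos w}"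
          using posM[OF u(1)] by (metis Diff_iff Diff_insert_absorb IntD2 subset_insert_iff insert_absorb subset_insert)
        moreover have "path_image (\<gamma> u w) - pos ` M \<subseteq> star S"
          unfolding star_def using u 3(1) N by (intro subsetI UnI2 UN_I[of u] UN_I[of w]) auto
        moreover have "pos w \<in> pos ` N" using 3(1) by (rule imageI)
        ultimately have "path_image (\<gamma> u w) \<subseteq> ?T"
          by (rule subset_cover)
        moreover have "path_connected (path_image (\<gamma> u w))"
          using e by (simp add: arc_imp_path path_connected_path_image)
        moreover have "pos u \<in> path_image (\<gamma> u w)" "pos w \<in> path_image (\<gamma> u w)"
          using e by (metis pathstart_in_path_image, metis pathfinish_in_path_image)
        ultimately have "path_component ?T (pos w) (pos u)"
          by (meson path_component_of_subset path_connected_component)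
        then show ?thesis using vert[OF u(1)] 3 path_component_trans by blast
      qed (use vert in auto)
    qed
    then show ?thesis unfolding path_connected_component
      by (meson path_component_sym path_component_trans)
  qed
  define p q r where "p = pos m1" and "q = pos m2" and "r = pos m3"
  have pqr: "p \<noteq> q" "p \<noteq> r" "q \<noteq> r" using m by (auto simp: p_def q_def r_def pos_eq)
  have ex_arc: "\<exists>g. arc g \<and> path_image g \<subseteq> star S \<union> {p, q} \<and> pathstart g = p \<and> pathfinish g = q"
    if "attached_set V adj M S" for S
    using star_conn[OF that, of "{m1, m2}"] pqr unfolding path_connected_arcwise
    by (simp add: M_def p_def q_def)
  note S' = S[folded M_def]
  have notin: "p \<notin> star S" "q \<notin> star S" "r \<notin> star S" if "attached_set V adj M S" for S
    using star_M[OF that] by (auto simp: M_def p_def q_def r_def)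
  obtain A where A: "arc A" "path_image A \<subseteq> star S1 \<union> {p, q}" "pathstart A = p" "pathfinish A = q"
    using ex_arc[OF S'(1)] by blast
  obtain B where B: "arc B" "path_image B \<subseteq> star S2 \<union> {p, q}" "pathstart B = p" "pathfinish B = q"
    using ex_arc[OF S'(2)] by blast
  obtain C where C: "arc C" "path_image C \<subseteq> star S3 \<union> {p, q}" "pathstart C = p" "pathfinish C = q"
    using ex_arc[OF S'(3)] by blast
  have ends: "{p, q} \<subseteq> path_image A" "{p, q} \<subseteq> path_image B" "{p, q} \<subseteq> path_image C"
    using A B C by (metis empty_subsetI insert_subset pathstart_in_path_image pathfinish_in_path_image)+
  note d = star_disj[OF disj(1) S'(1,2)] star_disj[OF disj(2) S'(1,3)] star_disj[OF disj(3) S'(2,3)]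
  \<comment> \<open>The connecting set is the star around \<open>R\<close> together with
    \<open>r\<close>; it misses \<open>P\<close> and \<open>Q\<close>, which run in the other two
    stars apart from their ends.\<close>
  have acc: "connected_component (- (path_image P \<union> path_image Q)) r x"
    if "attached_set V adj M S" and S': "attached_set V adj M S'" and S'': "attached_set V adj M S''"
      and disj: "star S \<inter> star S' = {}" "star S \<inter> star S'' = {}"
      and PQ: "path_image P \<subseteq> star S' \<union> {p, q}" "path_image Q \<subseteq> star S'' \<union> {p, q}"
      and R: "path_image R \<subseteq> star S \<union> {p, q}" and x: "x \<in> path_image R - {p, q}"
    for S S' S'' P Q R x
  proof -
    have "connected (star S \<union> {r})"
      using star_conn[OF that(1), of "{m3}"] by (simp add: M_def r_def path_connected_imp_connected)
    moreover have "star S \<union> {r} \<subseteq> - (path_image P \<union> path_image Q)"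
      using PQ disj notin[OF that(1)] notin(3)[OF S'] notin(3)[OF S''] pqr by blast
    moreover have "x \<in> star S" using R x by blast
    ultimately show ?thesis
      by (elim connected_componentI) simp_all
  qed
  have pair: "P \<inter> Q = {p, q}"
    if "P \<subseteq> S \<union> {p, q}" "Q \<subseteq> S' \<union> {p, q}" "S \<inter> S' = {}" "{p, q} \<subseteq> P" "{p, q} \<subseteq> Q" for P Q S S'
    using that by blast
  have r: "r \<notin> P" if "P \<subseteq> star S \<union> {p, q}" "attached_set V adj M S" for P S
    using that notin(3) pqr by blast
  have d': "star S2 \<inter> star S1 = {}" "star S3 \<inter> star S1 = {}" "star S3 \<inter> star S2 = {}"
    using d by (simp_all only: Int_commute)
  have r: "r \<notin> path_image A \<union> path_image B \<union> path_image C"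
    using r[OF A(2) S'(1)] r[OF B(2) S'(2)] r[OF C(2) S'(3)] by (simp only: Un_iff simp_thms)
  show False
  proof (rule theta_accessible[OF A(1) B(1) C(1) A(3) B(3) C(3) A(4) B(4) C(4)
      pair[OF A(2) B(2) d(1) ends(1,2)] pair[OF A(2) C(2) d(2) ends(1,3)] pair[OF B(2) C(2) d(3) ends(2,3)] r])
  qed (erule acc[OF S' d(1,2) B(2) C(2) A(2)] acc[OF S'(2,1,3) d'(1) d(3) A(2) C(2) B(2)]
      acc[OF S'(3,1,2) d'(2,3) A(2) B(2) C(2)])+
qed

text \<open>An injective linear map carries the drawing from pairs of reals to the complex plane,
  preserving arcs and intersections.\<close>

lemma planar_graph_no_K33_minor:
  assumes "planar_graph V adj"
    and m: "m1 \<in> V" "m2 \<in> V" "m3 \<in> V" "m1 \<noteq> m2" "m1 \<noteq> m3" "m2 \<noteq> m3"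
    and S: "attached_set V adj {m1, m2, m3} S1" "attached_set V adj {m1, m2, m3} S2"
      "attached_set V adj {m1, m2, m3} S3"
    and disj: "S1 \<inter> S2 = {}" "S1 \<inter> S3 = {}" "S2 \<inter> S3 = {}"
  shows False
proof -
  obtain pos :: "'a \<Rightarrow> real \<times> real" and \<gamma> where inj: "inj_on pos V"
    and edge: "\<forall>u\<in>V. \<forall>v\<in>V. adj u v \<longrightarrow>
          arc (\<gamma> u v) \<and> pathstart (\<gamma> u v) = pos u \<and> pathfinish (\<gamma> u v) = pos v \<and>
          path_image (\<gamma> u v) \<inter> pos ` V = {pos u, pos v}"
    and cross: "\<forall>u\<in>V. \<forall>v\<in>V. \<forall>x\<in>V. \<forall>y\<in>V. adj u v \<and> adj x y \<and> {u, v} \<noteq> {x, y} \<longrightarrow>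
          path_image (\<gamma> u v) \<inter> path_image (\<gamma> x y) \<subseteq> pos ` ({u, v} \<inter> {x, y})"
    using assms(1) unfolding planar_graph_def by (elim exE conjE) (rule that)
  define h where "h z = Complex (fst z) (snd z)" for z
  have linh: "linear h" by (rule linearI) (auto simp: h_def complex_eq_iff)
  have injh: "inj h" by (auto simp: h_def inj_def prod_eq_iff)
  have hI: "h ` K \<inter> h ` Y = h ` (K \<inter> Y)" for K Y using injh by (simp add: image_Int)
  show False
  proof (rule no_K33_drawing[OF _ _ _ m S disj, of "h \<circ> pos" "\<lambda>u v. h \<circ> \<gamma> u v"])
    show "inj_on (h \<circ> pos) V" using inj injh by (meson comp_inj_on inj_on_subset subset_UNIV)
  next
    fix u v assume "u \<in> V" "v \<in> V" "adj u v"
    then have e: "arc (\<gamma> u v)" "pathstart (\<gamma> u v) = pos u" "pathfinish (\<gamma> u v) = pos v"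
      "path_image (\<gamma> u v) \<inter> pos ` V = {pos u, pos v}" using edge by blast+
    have "path_image (h \<circ> \<gamma> u v) \<inter> (h \<circ> pos) ` V = h ` {pos u, pos v}"
      unfolding path_image_compose image_comp[symmetric] hI e(4) ..
    then show "arc (h \<circ> \<gamma> u v) \<and> pathstart (h \<circ> \<gamma> u v) = (h \<circ> pos) u \<and>
       pathfinish (h \<circ> \<gamma> u v) = (h \<circ> pos) v \<and>
       path_image (h \<circ> \<gamma> u v) \<inter> (h \<circ> pos) ` V = {(h \<circ> pos) u, (h \<circ> pos) v}"
      using e by (simp add: arc_linear_image_eq[OF linh injh] pathstart_compose pathfinish_compose)
  next
    fix u v x y assume "u \<in> V" "v \<in> V" "x \<in> V" "y \<in> V" "adj u v" "adj x y" "{u, v} \<noteq> {x, y}"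
    then have "path_image (\<gamma> u v) \<inter> path_image (\<gamma> x y) \<subseteq> pos ` ({u, v} \<inter> {x, y})" using cross by blast
    then show "path_image (h \<circ> \<gamma> u v) \<inter> path_image (h \<circ> \<gamma> x y) \<subseteq> (h \<circ> pos) ` ({u, v} \<inter> {x, y})"
      unfolding path_image_compose image_comp[symmetric] hI by (rule image_mono)
  qed
qed

section \<open>Covers in the subgroup lattice\<close>

lemma wf_subgroup_acc:
  assumes "subgroup_acc G"
  shows "wf {(K, H). subgroup H G \<and> subgroup K G \<and> H \<subset> K}"
  unfolding wf_iff_no_infinite_down_chain
proof (intro notI, elim exE)
  fix f assume *: "\<forall>i. (f (Suc i), f i) \<in> {(K, H). subgroup H G \<and> subgroup K G \<and> H \<subset> K}"
  have "subgroup (f n) G" "f n \<subset> f (Suc n)" for n using *[rule_format, of n] by simp_all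
  then show False using assms unfolding subgroup_acc_def by meson
qed

lemma wf_subgroup_dcc:
  assumes "subgroup_dcc G"
  shows "wf {(H, K). subgroup H G \<and> subgroup K G \<and> H \<subset> K}"
  unfolding wf_iff_no_infinite_down_chain
proof (intro notI, elim exE)
  fix f assume *: "\<forall>i. (f (Suc i), f i) \<in> {(H, K). subgroup H G \<and> subgroup K G \<and> H \<subset> K}"
  have "subgroup (f n) G" "f (Suc n) \<subset> f n" for n using *[rule_format, of n] by simp_all
  then show False using assms unfolding subgroup_dcc_def by meson
qed

lemma subgroup_acc_maximal:
  assumes "subgroup_acc G" "P H" "\<And>H. P H \<Longrightarrow> subgroup H G"
  obtains M where "P M" "H \<subseteq> M" "\<And>K. P K \<Longrightarrow> M \<subset> K \<Longrightarrow> False"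
proof -
  have H: "H \<in> {K. P K \<and> H \<subseteq> K}" using assms(2) by simp
  obtain M where M: "M \<in> {K. P K \<and> H \<subseteq> K}"
      "\<And>K. (K, M) \<in> {(K, H). subgroup H G \<and> subgroup K G \<and> H \<subset> K} \<Longrightarrow> K \<notin> {K. P K \<and> H \<subseteq> K}"
    by (rule wfE_min[OF wf_subgroup_acc[OF assms(1)] H]) (rule that)
  have max: "False" if "P K" "M \<subset> K" for K
  proof -
    have "K \<notin> {K. P K \<and> H \<subseteq> K}"
      by (rule M(2)) (use that M(1) assms(3) in simp)
    then show False using that M(1) by auto
  qed
  show thesis by (rule that[OF _ _ max]) (use M(1) in simp_all)
qed

lemma subgroup_dcc_minimal:
  assumes "subgroup_dcc G" "P H" "\<And>H. P H \<Longrightarrow> subgroup H G"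
  obtains M where "P M" "M \<subseteq> H" "\<And>K. P K \<Longrightarrow> K \<subset> M \<Longrightarrow> False"
proof -
  have H: "H \<in> {K. P K \<and> K \<subseteq> H}" using assms(2) by simp
  obtain M where M: "M \<in> {K. P K \<and> K \<subseteq> H}"
      "\<And>K. (K, M) \<in> {(H, K). subgroup H G \<and> subgroup K G \<and> H \<subset> K} \<Longrightarrow> K \<notin> {K. P K \<and> K \<subseteq> H}"
    by (rule wfE_min[OF wf_subgroup_dcc[OF assms(1)] H]) (rule that)
  have max: "False" if "P K" "K \<subset> M" for K
  proof -
    have "K \<notin> {K. P K \<and> K \<subseteq> H}"
      by (rule M(2)) (use that M(1) assms(3) in simp)
    then show False using that M(1) by auto
  qed
  show thesis by (rule that[OF _ _ max]) (use M(1) in simp_all)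
qed

text \<open>A minimal member among the subgroups strictly above \<open>H\<close> and inside
  \<open>K\<close> covers \<open>H\<close>. Thus covers above need the descending condition, and
  dually covers below the ascending one.\<close>

lemma subgroup_dcc_cover_above:
  assumes "subgroup_dcc G" "subgroup H G" "subgroup K G" "H \<subset> K"
  obtains F where "maximal_subgroup_of G H F" "F \<subseteq> K"
proof -
  obtain M where M: "subgroup M G \<and> H \<subset> M" "M \<subseteq> K" "\<And>L. subgroup L G \<and> H \<subset> L \<Longrightarrow> L \<subset> M \<Longrightarrow> False"
    by (rule subgroup_dcc_minimal[OF assms(1), of "\<lambda>L. subgroup L G \<and> H \<subset> L" K]) (use assms in auto)
  have "L = H \<or> L = M" if "subgroup L G" "H \<subseteq> L" "L \<subseteq> M" for L
    using that M(3)[of L] by blast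
  then show thesis using that[of M] M(1,2) assms(2) unfolding maximal_subgroup_of_def by blast
qed

lemma subgroup_acc_cover_below:
  assumes "subgroup_acc G" "subgroup H G" "subgroup K G" "H \<subset> K"
  obtains F where "maximal_subgroup_of G F K" "H \<subseteq> F"
proof -
  obtain M where M: "subgroup M G \<and> M \<subset> K" "H \<subseteq> M" "\<And>L. subgroup L G \<and> L \<subset> K \<Longrightarrow> M \<subset> L \<Longrightarrow> False"
    by (rule subgroup_acc_maximal[OF assms(1), of "\<lambda>L. subgroup L G \<and> L \<subset> K" H]) (use assms in auto)
  have "L = M \<or> L = K" if "subgroup L G" "M \<subseteq> L" "L \<subseteq> K" for L
    using that M(3)[of L] by blast
  then show thesis using that[of M] M(1,2) assms(3) unfolding maximal_subgroup_of_def by blast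
qed

section \<open>Paths in the subgroup graph and the minor given by three covers\<close>

text \<open>Each step up to a cover exists by the descending condition, and the climb ends by the
  ascending one. The path stays among overgroups of \<open>H\<close>, hence in \<open>S\<close>;
  this makes the upper branch set connected.\<close>

lemma (in group) reach_carrier:
  assumes "subgroup_acc G" "subgroup_dcc G" "subgroup H G"
    and S: "\<And>K. subgroup K G \<Longrightarrow> H \<subseteq> K \<Longrightarrow> K \<in> S"
  shows "(\<lambda>a b. a \<in> S \<and> b \<in> S \<and> subgroup_graph_adj G a b)\<^sup>*\<^sup>* H (carrier G)"
proof -
  have "subgroup K G \<Longrightarrow> H \<subseteq> K \<Longrightarrow> (\<lambda>a b. a \<in> S \<and> b \<in> S \<and> subgroup_graph_adj G a b)\<^sup>*\<^sup>* K (carrier G)" for K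
  proof (induction K rule: wf_induct_rule[OF wf_subgroup_acc[OF assms(1)]])
    case (1 K)
    show ?case
    proof (cases "K = carrier G")
      case False
      then obtain F where F: "maximal_subgroup_of G K F"
        using subgroup_dcc_cover_above[OF assms(2) 1(2) subgroup_self] subgroup.subset[OF 1(2)] by blast
      then have F': "subgroup F G" "K \<subset> F" by (auto simp: maximal_subgroup_of_def)
      then have "(\<lambda>a b. a \<in> S \<and> b \<in> S \<and> subgroup_graph_adj G a b)\<^sup>*\<^sup>* F (carrier G)"
        using 1 by auto
      moreover have "K \<in> S \<and> F \<in> S \<and> subgroup_graph_adj G K F"
        using S 1 F F' by (auto simp: subgroup_graph_adj_def)
      ultimately show ?thesis by (rule converse_rtranclp_into_rtranclp[rotated])
    qed simp
  qed
  then show ?thesis using assms(3) by blast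
qed

lemma (in group) reach_trivial:
  assumes "subgroup_acc G" "subgroup_dcc G" "subgroup H G"
    and S: "\<And>K. subgroup K G \<Longrightarrow> K \<subseteq> H \<Longrightarrow> K \<in> S"
  shows "(\<lambda>a b. a \<in> S \<and> b \<in> S \<and> subgroup_graph_adj G a b)\<^sup>*\<^sup>* H {\<one>}"
proof -
  have "subgroup K G \<Longrightarrow> K \<subseteq> H \<Longrightarrow> (\<lambda>a b. a \<in> S \<and> b \<in> S \<and> subgroup_graph_adj G a b)\<^sup>*\<^sup>* K {\<one>}" for K
  proof (induction K rule: wf_induct_rule[OF wf_subgroup_dcc[OF assms(2)]])
    case (1 K)
    show ?case
    proof (cases "K = {\<one>}")
      case False
      then have K: "{\<one>} \<subset> K" using subgroup.one_closed[OF 1(2)] by blast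
      obtain F where F: "maximal_subgroup_of G F K" "{\<one>} \<subseteq> F"
        by (rule subgroup_acc_cover_below[OF assms(1) triv_subgroup 1(2) K])
      then have F': "subgroup F G" "F \<subset> K" by (auto simp: maximal_subgroup_of_def)
      then have "(\<lambda>a b. a \<in> S \<and> b \<in> S \<and> subgroup_graph_adj G a b)\<^sup>*\<^sup>* F {\<one>}"
        using 1 by auto
      moreover have "K \<in> S \<and> F \<in> S \<and> subgroup_graph_adj G K F"
        using S 1 F F' by (auto simp: subgroup_graph_adj_def)
      ultimately show ?thesis by (rule converse_rtranclp_into_rtranclp[rotated])
    qed simp
  qed
  then show ?thesis using assms(3) by blast
qed

text \<open>
  The branch sets are \<open>{E}\<close>, the proper overgroups of the three covers, connected through \<open>G\<close>, and the
  proper subgroups of the covers not containing \<open>E\<close>, connected through the trivial subgroup.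
\<close>
lemma (in group) planar_three_covers:
  assumes planar: "planar_group G" and acc: "subgroup_acc G" and dcc: "subgroup_dcc G"
    and distinct: "F1 \<noteq> F2" "F1 \<noteq> F3" "F2 \<noteq> F3"
    and cover: "\<And>F. F \<in> {F1, F2, F3} \<Longrightarrow> maximal_subgroup_of G E F"
    and T: "\<And>F. F \<in> {F1, F2, F3} \<Longrightarrow> \<exists>T. subgroup T G \<and> T \<subseteq> F \<and> \<not> T \<subseteq> E \<and> \<not> E \<subseteq> T"
  shows False
proof -
  define Fs where "Fs = {F1, F2, F3}"
  have E: "subgroup E G" and F: "\<And>F. F \<in> Fs \<Longrightarrow> subgroup F G \<and> E \<subset> F"
    using cover by (auto simp: maximal_subgroup_of_def Fs_def)
  have between: "L = E \<or> L = F" if "F \<in> Fs" "subgroup L G" "E \<subseteq> L" "L \<subseteq> F" for L F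
    using cover that by (auto simp: maximal_subgroup_of_def Fs_def)
  have anti: "\<not> F \<subset> F'" if "F \<in> Fs" "F' \<in> Fs" for F F'
    using between[of F' F] F that by blast
  have ne: "\<exists>F'\<in>Fs. F' \<noteq> F" for F using distinct by (auto simp: Fs_def)
  define V where "V = subgroup_graph_vertices G"
  have V: "H \<in> V \<longleftrightarrow> subgroup H G" for H by (simp add: V_def subgroup_graph_vertices_def)
  define U where "U = {H. subgroup H G \<and> (\<exists>F\<in>Fs. F \<subset> H)}"
  define L where "L = {H. subgroup H G \<and> (\<exists>F\<in>Fs. H \<subset> F) \<and> \<not> E \<subseteq> H}"
  \<comment> \<open>No cover is the whole group, since it would then properly contain the other
    two.\<close>
  have FG: "F \<subset> carrier G" if "F \<in> Fs" for F
    using that ne[of F] anti F subgroup.subset by (metis psubsetI)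
  have "attached_set V (subgroup_graph_adj G) Fs {E}"
    using E F cover unfolding attached_set_def by (auto simp: V Fs_def subgroup_graph_adj_def)
  moreover have "attached_set V (subgroup_graph_adj G) Fs U"
    unfolding attached_set_def
  proof (intro conjI ballI)
    show "\<exists>u\<in>U. subgroup_graph_adj G u F" if F_in: "F \<in> Fs" for F
    proof -
      obtain H where "maximal_subgroup_of G F H" "H \<subseteq> carrier G"
        by (rule subgroup_dcc_cover_above[OF dcc conjunct1[OF F[OF F_in]] subgroup_self FG[OF F_in]])
      then show ?thesis using F_in
        by (intro bexI[of _ H]) (auto simp: U_def maximal_subgroup_of_def subgroup_graph_adj_def)
    qed
    show "\<exists>u\<^sub>0\<in>U. \<forall>u\<in>U. (\<lambda>a b. a \<in> U \<and> b \<in> U \<and> subgroup_graph_adj G a b)\<^sup>*\<^sup>* u u\<^sub>0"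
    proof (intro bexI ballI)
      show "carrier G \<in> U" using FG subgroup_self by (auto simp: U_def Fs_def)
      show "(\<lambda>a b. a \<in> U \<and> b \<in> U \<and> subgroup_graph_adj G a b)\<^sup>*\<^sup>* u (carrier G)" if "u \<in> U" for u
      proof (rule reach_carrier[OF acc dcc])
        show "subgroup u G" using that by (simp add: U_def)
        show "K \<in> U" if "subgroup K G" "u \<subseteq> K" for K
          using that \<open>u \<in> U\<close> unfolding U_def by (blast intro: psubset_subset_trans)
      qed
    qed
  qed (use anti V in \<open>auto simp: U_def\<close>)
  moreover have "attached_set V (subgroup_graph_adj G) Fs L"
    unfolding attached_set_def
  proof (intro conjI ballI)
    show "\<exists>u\<in>L. subgroup_graph_adj G u F" if F_in: "F \<in> Fs" for F
    proof -
      obtain T where T: "subgroup T G" "T \<subseteq> F" "\<not> T \<subseteq> E" "\<not> E \<subseteq> T"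
        using T[OF F_in[unfolded Fs_def]] by blast
      then have TF: "T \<subset> F" using F[OF F_in] by blast
      obtain H where H: "maximal_subgroup_of G H F" "T \<subseteq> H"
        by (rule subgroup_acc_cover_below[OF acc T(1) conjunct1[OF F[OF F_in]] TF])
      \<comment> \<open>A subgroup between \<open>E\<close> and \<open>F\<close> is one of them;
        \<open>H\<close> is neither, as it contains \<open>T\<close> and is proper in
        \<open>F\<close>.\<close>
      then have "\<not> E \<subseteq> H" using between[OF F_in, of H] T(3) by (auto simp: maximal_subgroup_of_def)
      then show ?thesis using F_in H
        by (intro bexI[of _ H]) (auto simp: L_def maximal_subgroup_of_def subgroup_graph_adj_def)
    qed
    show "\<exists>u\<^sub>0\<in>L. \<forall>u\<in>L. (\<lambda>a b. a \<in> L \<and> b \<in> L \<and> subgroup_graph_adj G a b)\<^sup>*\<^sup>* u u\<^sub>0"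
    proof (intro bexI ballI)
      have F1: "F1 \<in> Fs" by (simp add: Fs_def)
      obtain T where T: "subgroup T G" "\<not> E \<subseteq> T"
        using T[OF F1[unfolded Fs_def]] by (elim exE conjE) (rule that)
      have "\<not> E \<subseteq> {\<one>}" using T subgroup.one_closed by fastforce
      moreover have "{\<one>} \<subset> F1"
        using F[OF F1] subgroup.one_closed[OF E] by blast
      ultimately show "{\<one>} \<in> L" using F1 triv_subgroup unfolding L_def by blast
      show "(\<lambda>a b. a \<in> L \<and> b \<in> L \<and> subgroup_graph_adj G a b)\<^sup>*\<^sup>* u {\<one>}" if "u \<in> L" for u
      proof (rule reach_trivial[OF acc dcc])
        show "subgroup u G" using that by (simp add: L_def)
        show "K \<in> L" if "subgroup K G" "K \<subseteq> u" for K
          using that \<open>u \<in> L\<close> unfolding L_def by (blast intro: subset_psubset_trans)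
      qed
    qed
  qed (use F V in \<open>auto simp: L_def\<close>)
  moreover have "E \<subset> H" if "H \<in> U" for H
    using F that unfolding U_def by (blast intro: psubset_trans)
  then have "{E} \<inter> U = {}" "{E} \<inter> L = {}" "U \<inter> L = {}"
    unfolding L_def by blast+
  ultimately show False
    using planar_graph_no_K33_minor[of V "subgroup_graph_adj G" F1 F2 F3 "{E}" U L] planar distinct F V
    unfolding planar_group_def V_def Fs_def by simp
qed

section \<open>Infinite families of subgroups\<close>

text \<open>Let \<open>E\<close> be maximal with infinitely many members of \<open>DD\<close> above
  it. Each of these other than \<open>E\<close> lies above a cover of \<open>E\<close>, and by
  maximality each cover lies below only finitely many members, so infinitely many covers
  occur.\<close>

lemma infinite_covers:
  assumes acc: "subgroup_acc G" and dcc: "subgroup_dcc G"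
    and E0: "subgroup E0 G" and inf: "infinite DD" and D: "\<And>D. D \<in> DD \<Longrightarrow> subgroup D G \<and> E0 \<subseteq> D"
  obtains E where "subgroup E G" "E0 \<subseteq> E" "infinite {F. maximal_subgroup_of G E F \<and> (\<exists>D\<in>DD. F \<subseteq> D)}"
proof -
  have eq: "{D \<in> DD. E0 \<subseteq> D} = DD" using D by blast
  obtain E where E: "subgroup E G \<and> infinite {D \<in> DD. E \<subseteq> D}" "E0 \<subseteq> E"
    and max: "\<And>K. subgroup K G \<and> infinite {D \<in> DD. K \<subseteq> D} \<Longrightarrow> E \<subset> K \<Longrightarrow> False"
    by (rule subgroup_acc_maximal[OF acc, of "\<lambda>E. subgroup E G \<and> infinite {D \<in> DD. E \<subseteq> D}" E0])
      (use E0 inf eq in auto)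
  let ?FF = "{F. maximal_subgroup_of G E F \<and> (\<exists>D\<in>DD. F \<subseteq> D)}"
  have "infinite ?FF"
  proof
    assume fin: "finite ?FF"
    have "{D \<in> DD. E \<subseteq> D} \<subseteq> insert E (\<Union>F\<in>?FF. {D \<in> DD. F \<subseteq> D})"
    proof
      fix D' assume D': "D' \<in> {D \<in> DD. E \<subseteq> D}"
      show "D' \<in> insert E (\<Union>F\<in>?FF. {D \<in> DD. F \<subseteq> D})"
      proof (cases "D' = E")
        case False
        then obtain F where "maximal_subgroup_of G E F" "F \<subseteq> D'"
          using subgroup_dcc_cover_above[OF dcc, of E D'] E D D' by auto
        then show ?thesis using D' by blast
      qed simp
    qed
    moreover have "finite {D \<in> DD. F \<subseteq> D}" if "F \<in> ?FF" for F
      using max[of F] that by (auto simp: maximal_subgroup_of_def)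
    ultimately show False using E(1) fin by (meson finite_UN_I finite_insert finite_subset)
  qed
  then show thesis using that E by blast
qed

text \<open>The chain conditions supply \<open>E\<close> without further information, so the witness
  \<open>T\<close> is required for every proper inclusion of \<open>E\<close> in \<open>F\<close>
  below a member of \<open>DD\<close>. Three of the infinitely many covers then give the
  minor.\<close>

lemma (in group) planar_infinite_family:
  assumes planar: "planar_group G" and acc: "subgroup_acc G" and dcc: "subgroup_dcc G"
    and E0: "subgroup E0 G" and inf: "infinite DD" and D: "\<And>D. D \<in> DD \<Longrightarrow> subgroup D G \<and> E0 \<subseteq> D"
    and T: "\<And>E F D. subgroup E G \<Longrightarrow> subgroup F G \<Longrightarrow> D \<in> DD \<Longrightarrow> E0 \<subseteq> E \<Longrightarrow> E \<subset> F \<Longrightarrow> F \<subseteq> D \<Longrightarrow>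
       \<exists>T. subgroup T G \<and> T \<subseteq> F \<and> \<not> T \<subseteq> E \<and> \<not> E \<subseteq> T"
  shows False
proof -
  obtain E where E: "subgroup E G" "E0 \<subseteq> E" "infinite {F. maximal_subgroup_of G E F \<and> (\<exists>D\<in>DD. F \<subseteq> D)}"
    using infinite_covers[OF acc dcc E0 inf D] .
  obtain C where "finite C" and C: "card C = 3" "C \<subseteq> {F. maximal_subgroup_of G E F \<and> (\<exists>D\<in>DD. F \<subseteq> D)}"
    using infinite_arbitrarily_large[OF E(3), of 3] by (elim exE conjE) (rule that)
  then obtain F1 F2 F3 where F: "C = {F1, F2, F3}" "F1 \<noteq> F2" "F1 \<noteq> F3" "F2 \<noteq> F3"
    by (metis card_3_iff)
  show False
  proof (rule planar_three_covers[OF planar acc dcc F(2-4)])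
    show "maximal_subgroup_of G E F" if "F \<in> {F1, F2, F3}" for F using that C F by blast
    show "\<exists>T. subgroup T G \<and> T \<subseteq> F \<and> \<not> T \<subseteq> E \<and> \<not> E \<subseteq> T" if "F \<in> {F1, F2, F3}" for F
    proof -
      have "maximal_subgroup_of G E F" "\<exists>D\<in>DD. F \<subseteq> D" using that C F by blast+
      then obtain D where "subgroup F G" "E \<subset> F" "D \<in> DD" "F \<subseteq> D"
        unfolding maximal_subgroup_of_def by blast
      then show ?thesis using T[OF E(1) _ _ E(2)] by blast
    qed
  qed
qed

section \<open>Involutions modulo a finite subgroup\<close>

lemma (in group) ord_nonzero_if_dcc:
  assumes dcc: "subgroup_dcc G" and x: "x \<in> carrier G"
  shows "ord x \<noteq> 0"
proof
  assume "ord x = 0"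
  then have inj: "x [^] m = x [^] n \<longleftrightarrow> m = n" for m n :: int
    using int_pow_eq[OF x] by auto
  \<comment> \<open>For \<open>x\<close> of infinite order the cyclic groups generated by the powers
    with exponent \<open>2 ^ n\<close> descend strictly.\<close>
  define f where "f n = generate G {x [^] (2 ^ n :: int)}" for n :: nat
  have gen: "f n = {x [^] (2 ^ n * k :: int) | k. True}" for n
    unfolding f_def using x by (simp add: generate_pow int_pow_pow)
  have "f (Suc n) \<subset> f n" for n
  proof
    show "f (Suc n) \<subseteq> f n"
    proof
      fix a assume "a \<in> f (Suc n)"
      then obtain k where "a = x [^] (2 ^ Suc n * k :: int)" unfolding gen by blast
      moreover have "(2::int) ^ Suc n * k = 2 ^ n * (2 * k)" by simp
      ultimately have "a = x [^] (2 ^ n * (2 * k))" by (simp only:)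
      then show "a \<in> f n" unfolding gen by blast
    qed
    have "x [^] (2 ^ n :: int) \<in> f n" unfolding gen by (auto intro!: exI[of _ 1])
    moreover have "x [^] (2 ^ n :: int) \<notin> f (Suc n)"
    proof
      assume "x [^] (2 ^ n :: int) \<in> f (Suc n)"
      then obtain k where "x [^] (2 ^ n :: int) = x [^] (2 ^ Suc n * k :: int)" unfolding gen by blast
      then have "(2::int) ^ n = 2 ^ n * (2 * k)" unfolding inj by simp
      then have "2 * k = 1" by simp
      then show False by presburger
    qed
    ultimately show "f (Suc n) \<noteq> f n" by blast
  qed
  moreover have "subgroup (f n) G" for n
    unfolding f_def using x by (intro generate_is_subgroup) auto
  ultimately show False using dcc unfolding subgroup_dcc_def by meson
qed

text \<open>With \<open>c = x \<otimes> y\<close> the group consists of the rotations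
  \<open>pw k\<close> and the reflections \<open>x \<otimes> pw k\<close>. Reflections square to
  one, and \<open>x\<close> times a rotation is a reflection; the disjunction records this.\<close>

lemma (in group) dihedral_subgroup:
  assumes x: "x \<in> carrier G" "x \<otimes> x = \<one>" and y: "y \<in> carrier G" "y \<otimes> y = \<one>"
    and fin: "ord (x \<otimes> y) \<noteq> 0"
  obtains D where "subgroup D G" "finite D" "x \<in> D" "y \<in> D"
    "\<And>d. d \<in> D \<Longrightarrow> d \<otimes> d = \<one> \<or> (x \<otimes> d) \<otimes> (x \<otimes> d) = \<one>"
proof -
  define c where "c = x \<otimes> y"
  have c: "c \<in> carrier G" using x y by (simp add: c_def)
  define pw where "pw k = c [^] k" for k :: int
  have pw [simp]: "pw k \<in> carrier G" for k using c by (simp add: pw_def)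
  have pw_add: "pw j \<otimes> pw k = pw (j + k)" for j k using c by (simp add: pw_def int_pow_mult)
  have pw0: "pw 0 = \<one>" by (simp add: pw_def)
  have inv_pw: "inv (pw k) = pw (- k)" for k using c by (simp add: pw_def int_pow_neg)
  have inv_x: "inv x = x" "inv y = y" using x y by (simp_all add: inv_equality)
  have xx: "x \<otimes> (x \<otimes> a) = a" if "a \<in> carrier G" for a using x that by (simp flip: m_assoc)
  have hom: "(\<lambda>g. x \<otimes> g \<otimes> x) \<in> hom G G"
    using x xx by (auto simp: hom_def m_assoc)
  have "x \<otimes> c \<otimes> x = inv c"
    using x y xx by (simp add: c_def inv_mult_group inv_x m_assoc)
  then have conj: "x \<otimes> pw k \<otimes> x = pw (- k)" for k
    using hom_int_pow[OF hom c is_group is_group, of k] c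
    by (simp add: pw_def int_pow_neg int_pow_inv)
  have swap: "pw k \<otimes> x = x \<otimes> pw (- k)" for k
    using arg_cong[OF conj[of k], of "\<lambda>g. x \<otimes> g"] x by (simp add: m_assoc xx)
  have swap': "pw k \<otimes> (x \<otimes> a) = x \<otimes> (pw (- k) \<otimes> a)" if "a \<in> carrier G" for k a
    using swap[of k] x that by (metis m_assoc pw)
  define D where "D = range pw \<union> range (\<lambda>k. x \<otimes> pw k)"
  have D: "d \<in> D \<longleftrightarrow> (\<exists>k. d = pw k \<or> d = x \<otimes> pw k)" for d by (auto simp: D_def)
  have Dpw: "pw k \<in> D" "x \<otimes> pw k \<in> D" for k by (auto simp: D)
  have "subgroup D G"
  proof (rule subgroupI)
    show "D \<subseteq> carrier G" using x by (auto simp: D)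
    show "D \<noteq> {}" using Dpw by blast
    show "inv a \<in> D" if "a \<in> D" for a
      using that x Dpw by (auto simp: D inv_pw inv_mult_group inv_x swap)
    show "a \<otimes> b \<in> D" if "a \<in> D" "b \<in> D" for a b
      using that x Dpw unfolding D[of a] D[of b] by (auto simp: pw_add m_assoc swap' xx)
  qed
  moreover have "finite D"
  proof -
    have "range pw = carrier (subgroup_generated G {c})"
      using carrier_subgroup_generated_by_singleton[OF c] by (auto simp: pw_def)
    then have "finite (range pw)" using finite_cyclic_subgroup_order[OF c] fin by (simp add: c_def)
    moreover have "range (\<lambda>k. x \<otimes> pw k) = (\<lambda>a. x \<otimes> a) ` range pw" by auto
    ultimately show ?thesis by (simp add: D_def)
  qed
  moreover have "x \<in> D" using Dpw(2)[of 0] x by (simp add: pw0)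
  moreover have "y \<in> D" using Dpw(2)[of 1] x y c by (simp add: pw_def xx) (simp add: c_def xx)
  moreover have "d \<otimes> d = \<one> \<or> (x \<otimes> d) \<otimes> (x \<otimes> d) = \<one>" if "d \<in> D" for d
    using that x by (auto simp: D pw_add m_assoc swap' xx pw0)
  ultimately show thesis by (rule that)
qed

section \<open>Homomorphisms with finite kernel\<close>

lemma (in group_hom) subgroup_preimage:
  assumes "subgroup K H"
  shows "subgroup {g \<in> carrier G. h g \<in> K} G"
  using assms by (intro G.subgroupI) (auto simp: subgroup.one_closed subgroup.m_closed subgroup.m_inv_closed intro: exI[of _ "\<one>\<^bsub>G\<^esub>"])

text \<open>Each nonempty fibre is a coset of the finite kernel.\<close>

lemma (in group_hom) finite_preimage:
  assumes "finite (kernel G H h)" "finite K"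
  shows "finite {g \<in> carrier G. h g \<in> K}"
proof -
  have "finite {g \<in> carrier G. h g = k}" for k
  proof (cases "\<exists>g\<in>carrier G. h g = k")
    case True
    then obtain a where a: "a \<in> carrier G" "h a = k" by blast
    have "{g \<in> carrier G. h g = k} \<subseteq> (\<lambda>z. z \<otimes> a) ` kernel G H h"
    proof
      fix g assume "g \<in> {g \<in> carrier G. h g = k}"
      then have "g \<otimes> inv a \<in> kernel G H h" "g = (g \<otimes> inv a) \<otimes> a"
        using a by (auto simp: kernel_def G.m_assoc)
      then show "g \<in> (\<lambda>z. z \<otimes> a) ` kernel G H h" by blast
    qed
    then show ?thesis using assms(1) finite_surj by blast
  next
    case False
    then have "{g \<in> carrier G. h g = k} = {}" by blast
    then show ?thesis by (simp only: finite.emptyI)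
  qed
  moreover have "{g \<in> carrier G. h g \<in> K} = (\<Union>k\<in>K. {g \<in> carrier G. h g = k})" by blast
  ultimately show ?thesis using assms(2) by simp
qed

lemma (in group) involution_subgroup:
  assumes "x \<in> carrier G" "x \<otimes> x = \<one>"
  shows "subgroup {\<one>, x} G"
proof (rule subgroupI)
  have "inv x = x" using assms by (simp add: inv_equality)
  then show "inv a \<in> {\<one>, x}" if "a \<in> {\<one>, x}" for a using that by auto
qed (use assms in auto)

text \<open>Later arguments use only these two facts about the quotient of the normalizer by
  \<open>Z\<close>.\<close>

lemma (in group) normalizer_quotient:
  assumes "subgroup Z G"
  defines "M \<equiv> G\<lparr>carrier := normalizer G Z\<rparr>"
  shows "group_hom M (M Mod Z) (\<lambda>a. Z #>\<^bsub>M\<^esub> a)" "kernel M (M Mod Z) (\<lambda>a. Z #>\<^bsub>M\<^esub> a) = Z"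
proof -
  interpret Z: normal Z M unfolding M_def by (rule subgroup_in_normalizer[OF assms(1)])
  show "group_hom M (M Mod Z) (\<lambda>a. Z #>\<^bsub>M\<^esub> a)"
    using Z.r_coset_hom_Mod Z.factorgroup_is_group Z.is_group by (simp add: group_hom_def group_hom_axioms_def)
  have "Z #>\<^bsub>M\<^esub> a = Z \<longleftrightarrow> a \<in> Z" if "a \<in> carrier M" for a
    using Z.coset_join1[OF _ that Z.subgroup_axioms] Z.coset_join2[OF that Z.subgroup_axioms] by blast
  then show "kernel M (M Mod Z) (\<lambda>a. Z #>\<^bsub>M\<^esub> a) = Z"
    using Z.subset by (auto simp: kernel_def)
qed


text \<open>Under the descending condition \<open>g\<close> has finite order in \<open>G\<close>,
  and the order of its image divides it.\<close>

lemma (in group) ord_image_nonzero: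
  assumes dcc: "subgroup_dcc G" and N: "subgroup N G" and gh: "group_hom (G\<lparr>carrier := N\<rparr>) Q \<phi>"
    and g: "g \<in> N"
  shows "group.ord Q (\<phi> g) \<noteq> 0"
proof -
  interpret \<phi>: group_hom "G\<lparr>carrier := N\<rparr>" Q \<phi> by (rule gh)
  have gG: "g \<in> carrier G" using subgroup.mem_carrier[OF N g] .
  have "\<phi> g [^]\<^bsub>Q\<^esub> ord g = \<phi> (g [^] ord g)"
    using \<phi>.hom_nat_pow[of g "ord g"] g by (simp flip: nat_pow_consistent)
  also have "\<dots> = \<one>\<^bsub>Q\<^esub>" using gG \<phi>.hom_one by simp
  finally have "group.ord Q (\<phi> g) dvd ord g"
    using \<phi>.H.pow_eq_id[of "\<phi> g"] \<phi>.hom_closed[of g] g by simp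
  then show ?thesis using ord_nonzero_if_dcc[OF dcc gG] by auto
qed

text \<open>
  Here \<open>\<phi>\<close> plays the role of the projection \<open>N \<rightarrow> N/Z\<close> for a finite normal subgroup \<open>Z\<close>. The family
  consists of the preimages of the dihedral groups generated by \<open>\<phi> x\<close> and a second involution: every
  proper extension \<open>F\<close> of \<open>E\<close> inside such a preimage contains a new involution modulo \<open>Z\<close>.
\<close>
lemma (in group) finite_involutions_mod:
  assumes planar: "planar_group G" and acc: "subgroup_acc G" and dcc: "subgroup_dcc G"
    and N: "subgroup N G" and gh: "group_hom (G\<lparr>carrier := N\<rparr>) Q \<phi>"
    and fin: "finite (kernel (G\<lparr>carrier := N\<rparr>) Q \<phi>)"
    and x: "x \<in> N" "\<phi> x \<noteq> \<one>\<^bsub>Q\<^esub>" "\<phi> x \<otimes>\<^bsub>Q\<^esub> \<phi> x = \<one>\<^bsub>Q\<^esub>"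
  shows "finite {y \<in> N. \<phi> y \<otimes>\<^bsub>Q\<^esub> \<phi> y = \<one>\<^bsub>Q\<^esub>}" (is "finite ?I")
proof (rule ccontr)
  assume inf: "infinite ?I"
  interpret \<phi>: group_hom "G\<lparr>carrier := N\<rparr>" Q \<phi> by (rule gh)
  note NG = subgroup.mem_carrier[OF N]
  have \<phi>Q: "\<phi> g \<in> carrier Q" if "g \<in> N" for g using \<phi>.hom_closed that by simp
  have \<phi>m: "\<phi> (g \<otimes> h) = \<phi> g \<otimes>\<^bsub>Q\<^esub> \<phi> h" if "g \<in> N" "h \<in> N" for g h using \<phi>.hom_mult that by simp
  define P where "P K = {g \<in> N. \<phi> g \<in> K}" for K
  have subP: "subgroup (P K) G" if "subgroup K Q" for K
    using incl_subgroup[OF N \<phi>.subgroup_preimage[OF that]] by (simp add: P_def)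
  have finP: "finite (P K)" if "finite K" for K
    using \<phi>.finite_preimage[OF fin that] by (simp add: P_def)
  have inv2: "subgroup (P {\<one>\<^bsub>Q\<^esub>, \<phi> t}) G" if "t \<in> N" "\<phi> t \<otimes>\<^bsub>Q\<^esub> \<phi> t = \<one>\<^bsub>Q\<^esub>" for t
    using subP \<phi>.H.involution_subgroup[OF \<phi>Q] that by blast
  let ?E0 = "P {\<one>\<^bsub>Q\<^esub>, \<phi> x}"
  have ex: "\<forall>y\<in>?I. \<exists>D. subgroup D G \<and> finite D \<and> ?E0 \<subseteq> D \<and> y \<in> D \<and>
      (\<forall>d\<in>D. d \<in> N \<and> (\<phi> d \<otimes>\<^bsub>Q\<^esub> \<phi> d = \<one>\<^bsub>Q\<^esub> \<or> \<phi> (x \<otimes> d) \<otimes>\<^bsub>Q\<^esub> \<phi> (x \<otimes> d) = \<one>\<^bsub>Q\<^esub>))"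
    (is "\<forall>y\<in>?I. ?ex y")
  proof
    fix y assume y: "y \<in> ?I"
    have yN: "y \<in> N" "\<phi> y \<otimes>\<^bsub>Q\<^esub> \<phi> y = \<one>\<^bsub>Q\<^esub>" using y by auto
    have xyN: "x \<otimes> y \<in> N" using x yN subgroup.m_closed[OF N] by blast
    have "group.ord Q (\<phi> x \<otimes>\<^bsub>Q\<^esub> \<phi> y) \<noteq> 0"
      using ord_image_nonzero[OF dcc N gh xyN] x yN by (simp add: \<phi>m)
    then obtain D where D: "subgroup D Q" "finite D" "\<phi> x \<in> D" "\<phi> y \<in> D"
      "\<And>d. d \<in> D \<Longrightarrow> d \<otimes>\<^bsub>Q\<^esub> d = \<one>\<^bsub>Q\<^esub> \<or> (\<phi> x \<otimes>\<^bsub>Q\<^esub> d) \<otimes>\<^bsub>Q\<^esub> (\<phi> x \<otimes>\<^bsub>Q\<^esub> d) = \<one>\<^bsub>Q\<^esub>"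
      using \<phi>.H.dihedral_subgroup[OF \<phi>Q[OF x(1)] x(3) \<phi>Q[OF yN(1)] yN(2)] by metis
    show "?ex y"
    proof (intro exI conjI ballI)
      show "subgroup (P D) G" "finite (P D)" using D subP finP by blast+
      show "?E0 \<subseteq> P D" using D(3) subgroup.one_closed[OF D(1)] by (auto simp: P_def)
      show "y \<in> P D" using D(4) yN by (simp add: P_def)
      show "d \<in> N" if "d \<in> P D" for d using that by (simp add: P_def)
      show "\<phi> d \<otimes>\<^bsub>Q\<^esub> \<phi> d = \<one>\<^bsub>Q\<^esub> \<or> \<phi> (x \<otimes> d) \<otimes>\<^bsub>Q\<^esub> \<phi> (x \<otimes> d) = \<one>\<^bsub>Q\<^esub>" if "d \<in> P D" for d
        using that D(5)[of "\<phi> d"] x by (simp add: P_def \<phi>m)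
    qed
  qed
  obtain D where "\<forall>y\<in>?I. subgroup (D y) G \<and> finite (D y) \<and> ?E0 \<subseteq> D y \<and> y \<in> D y \<and>
      (\<forall>d\<in>D y. d \<in> N \<and> (\<phi> d \<otimes>\<^bsub>Q\<^esub> \<phi> d = \<one>\<^bsub>Q\<^esub> \<or> \<phi> (x \<otimes> d) \<otimes>\<^bsub>Q\<^esub> \<phi> (x \<otimes> d) = \<one>\<^bsub>Q\<^esub>))"
    using bchoice[OF ex] by (elim exE) (rule that)
  note D = this[rule_format]
  have "infinite (D ` ?I)"
  proof
    assume "finite (D ` ?I)"
    then have "finite (\<Union>(D ` ?I))" using D by blast
    moreover have "?I \<subseteq> \<Union>(D ` ?I)" using D by blast
    ultimately show False using inf finite_subset by blast
  qed
  then show False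
  proof (rule planar_infinite_family[OF planar acc dcc inv2[OF x(1,3)]])
    show "subgroup A G \<and> ?E0 \<subseteq> A" if "A \<in> D ` ?I" for A using that D by blast
    fix E F A
    assume E: "subgroup E G" and F: "subgroup F G" and A: "A \<in> D ` ?I" "?E0 \<subseteq> E" "E \<subset> F" "F \<subseteq> A"
    have xE: "x \<in> E" using A(2) x(1) by (auto simp: P_def)
    obtain f where f: "f \<in> F" "f \<notin> E" using A(3) by blast
    have fN: "f \<in> N" "\<phi> f \<otimes>\<^bsub>Q\<^esub> \<phi> f = \<one>\<^bsub>Q\<^esub> \<or> \<phi> (x \<otimes> f) \<otimes>\<^bsub>Q\<^esub> \<phi> (x \<otimes> f) = \<one>\<^bsub>Q\<^esub>"
      using f(1) A(1,4) D by blast+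
    have xf: "x \<otimes> f \<in> N" "x \<otimes> f \<in> F"
      using x fN xE A(3) f subgroup.m_closed[OF N] subgroup.m_closed[OF F] by blast+
    \<comment> \<open>As \<open>x\<close> lies in \<open>E\<close>, neither \<open>f\<close> nor
      \<open>x \<otimes> f\<close> does, so whichever of the two has an image squaring to one can
      serve as \<open>t\<close>.\<close>
    have "x \<otimes> f \<notin> E"
    proof
      assume "x \<otimes> f \<in> E"
      then have "inv x \<otimes> (x \<otimes> f) \<in> E" using xE E by (simp add: subgroup.m_closed subgroup.m_inv_closed)
      moreover have "inv x \<otimes> (x \<otimes> f) = f" using NG x(1) fN(1) by (simp flip: m_assoc)
      ultimately show False using f by simp
    qed
    then obtain t where t: "t \<in> N" "t \<in> F" "t \<notin> E" "\<phi> t \<otimes>\<^bsub>Q\<^esub> \<phi> t = \<one>\<^bsub>Q\<^esub>"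
      using f fN xf by blast
    \<comment> \<open>Elements with the same image differ by an element of the kernel, which lies in
      \<open>?E0\<close>; so for elements of \<open>N\<close> membership in a subgroup above
      \<open>?E0\<close> depends only on the image.\<close>
    have near: "a \<otimes> inv b \<in> ?E0" if "a \<in> N" "b \<in> N" "\<phi> a = \<phi> b" for a b
    proof -
      have m: "a \<otimes> inv b \<in> N" using that N by (simp add: subgroup.m_closed subgroup.m_inv_closed)
      have "\<phi> (a \<otimes> inv b) \<otimes>\<^bsub>Q\<^esub> \<phi> b = \<phi> a" using that m NG by (simp flip: \<phi>m) (simp add: m_assoc)
      then have "\<phi> (a \<otimes> inv b) = \<one>\<^bsub>Q\<^esub>" using that(2,3) m \<phi>Q
        by (metis \<phi>.H.one_closed \<phi>.H.right_cancel \<phi>.H.l_one)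
      then show ?thesis using m by (simp add: P_def)
    qed
    have mem: "a \<in> K" if "subgroup K G" "?E0 \<subseteq> K" "a \<in> N" "b \<in> N" "\<phi> a = \<phi> b" "b \<in> K" for a b K
    proof -
      have "(a \<otimes> inv b) \<otimes> b \<in> K" using near[of a b] that by (blast intro: subgroup.m_closed)
      then show ?thesis using NG that(3,4) by (simp add: m_assoc)
    qed
    show "\<exists>T. subgroup T G \<and> T \<subseteq> F \<and> \<not> T \<subseteq> E \<and> \<not> E \<subseteq> T"
    proof (intro exI conjI)
      show "subgroup (P {\<one>\<^bsub>Q\<^esub>, \<phi> t}) G" using inv2 t by blast
      have "a \<in> F" if a: "a \<in> N" "\<phi> a = \<one>\<^bsub>Q\<^esub> \<or> \<phi> a = \<phi> t" for a
      proof (cases "\<phi> a = \<one>\<^bsub>Q\<^esub>")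
        case True
        then have "a \<in> ?E0" using a by (simp add: P_def)
        then show ?thesis using A by blast
      next
        case False
        then have "\<phi> a = \<phi> t" using a by blast
        moreover have "?E0 \<subseteq> F" using A by blast
        ultimately show ?thesis using mem[OF F _ a(1) t(1) _ t(2)] by blast
      qed
      then show "P {\<one>\<^bsub>Q\<^esub>, \<phi> t} \<subseteq> F" by (auto simp: P_def)
      have "t \<in> P {\<one>\<^bsub>Q\<^esub>, \<phi> t}" using t by (simp add: P_def)
      then show "\<not> P {\<one>\<^bsub>Q\<^esub>, \<phi> t} \<subseteq> E" using t by blast
      \<comment> \<open>The image of \<open>x\<close> is nontrivial, so \<open>x\<close> in this
        group would have the image of \<open>t\<close>, and \<open>t\<close> would fall into
        \<open>E\<close>.\<close>
      show "\<not> E \<subseteq> P {\<one>\<^bsub>Q\<^esub>, \<phi> t}"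
      proof
        assume "E \<subseteq> P {\<one>\<^bsub>Q\<^esub>, \<phi> t}"
        then have "x \<in> P {\<one>\<^bsub>Q\<^esub>, \<phi> t}" using xE by blast
        then have "\<phi> t = \<phi> x" using x by (auto simp: P_def)
        then have "t \<in> E" using mem[OF E A(2) t(1) x(1) _ xE] by blast
        then show False using t by blast
      qed
    qed
  qed
qed

section \<open>Normalizers and enlarging a finite subgroup\<close>

text \<open>Conjugation by \<open>g\<close> gives one inclusion between \<open>H\<close> and its
  conjugate, conjugation by the inverse the other.\<close>

lemma (in group) normalizerI:
  assumes g: "g \<in> carrier G" and H: "H \<subseteq> carrier G"
    and 1: "\<And>h. h \<in> H \<Longrightarrow> g \<otimes> h \<otimes> inv g \<in> H" and 2: "\<And>h. h \<in> H \<Longrightarrow> inv g \<otimes> h \<otimes> g \<in> H"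
  shows "g \<in> normalizer G H"
proof -
  have "g <# H #> inv g = (\<lambda>h. g \<otimes> h \<otimes> inv g) ` H"
    by (auto simp: l_coset_def r_coset_def)
  also have "\<dots> = H"
  proof
    show "(\<lambda>h. g \<otimes> h \<otimes> inv g) ` H \<subseteq> H" using 1 by blast
    show "H \<subseteq> (\<lambda>h. g \<otimes> h \<otimes> inv g) ` H"
    proof
      fix h assume h: "h \<in> H"
      then have "h \<in> carrier G" using H by blast
      then have "g \<otimes> (inv g \<otimes> h \<otimes> g) \<otimes> inv g = g \<otimes> inv g \<otimes> h \<otimes> (g \<otimes> inv g)"
        using g by (simp only: m_assoc m_closed inv_closed)
      then have "h = g \<otimes> (inv g \<otimes> h \<otimes> g) \<otimes> inv g" using g \<open>h \<in> carrier G\<close> by simp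
      then show "h \<in> (\<lambda>h. g \<otimes> h \<otimes> inv g) ` H" using 2[OF h] by blast
    qed
  qed
  finally show ?thesis using g H by (simp add: normalizer_def stabilizer_def)
qed

lemma (in group) normalizerD:
  assumes "g \<in> normalizer G H" "H \<subseteq> carrier G" "h \<in> H"
  shows "g \<otimes> h \<otimes> inv g \<in> H"
proof -
  have "g <# H #> inv g = H" using assms by (simp add: normalizer_def stabilizer_def)
  then show ?thesis using assms(3) by (auto simp: l_coset_def r_coset_def)
qed

text \<open>Induction on \<open>m\<close>, passing from \<open>y\<close> to its square. It serves to
  push the 2-part of an element into \<open>Z\<close>.\<close>

lemma (in group) odd_order_modulo:
  assumes N: "subgroup N G" and Z: "\<And>y. y \<in> N \<Longrightarrow> y \<otimes> y \<in> Z \<Longrightarrow> y \<in> Z"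
  shows "y \<in> N \<Longrightarrow> y [^] ((2::nat) ^ m) \<in> Z \<Longrightarrow> y \<in> Z"
proof (induction m arbitrary: y)
  case 0
  then show ?case using subgroup.mem_carrier[OF N] by simp
next
  case (Suc m)
  note yG = subgroup.mem_carrier[OF N Suc.prems(1)]
  have "(y \<otimes> y) [^] ((2::nat) ^ m) = y [^] ((2::nat) ^ Suc m)"
    using yG nat_pow_pow[of y 2 "2 ^ m"] by (simp add: numeral_2_eq_2)
  then have "y \<otimes> y \<in> Z" using Suc subgroup.m_closed[OF N] by simp
  then show ?case using Z Suc by blast
qed

text \<open>
  The conjugates of \<open>x\<close> under the normalizer of \<open>Z\<close> are involutions modulo \<open>Z\<close>, hence finite in number,
  so the centralizer of \<open>x\<close> in that normalizer is infinite; it normalizes \<open>Z \<union> Z x\<close>.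
\<close>
lemma (in group) extend_finite_subgroup:
  assumes planar: "planar_group G" and acc: "subgroup_acc G" and dcc: "subgroup_dcc G"
    and Z: "subgroup Z G" "finite Z" and inf: "infinite (normalizer G Z)"
    and x: "x \<in> normalizer G Z" "x \<notin> Z" "x \<otimes> x \<in> Z"
  obtains Z' where "subgroup Z' G" "finite Z'" "Z \<subset> Z'" "x \<in> Z'" "infinite (normalizer G Z')"
proof -
  define N where "N = normalizer G Z"
  define M where "M = G\<lparr>carrier := N\<rparr>"
  define Q where "Q = M Mod Z"
  define \<phi> where "\<phi> = (\<lambda>a. Z #>\<^bsub>M\<^esub> a)"
  have N: "subgroup N G" unfolding N_def by (rule normalizer_imp_subgroup[OF subgroup.subset[OF Z(1)]])
  have gh: "group_hom (G\<lparr>carrier := N\<rparr>) Q \<phi>" and ker: "kernel (G\<lparr>carrier := N\<rparr>) Q \<phi> = Z"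
    using normalizer_quotient[OF Z(1)] unfolding Q_def \<phi>_def M_def N_def by blast+
  interpret \<phi>: group_hom "G\<lparr>carrier := N\<rparr>" Q \<phi> by (rule gh)
  note NG = subgroup.mem_carrier[OF N]
  note N_closed = subgroup.m_closed[OF N] subgroup.m_inv_closed[OF N]
  have \<phi>Q: "\<phi> g \<in> carrier Q" if "g \<in> N" for g using \<phi>.hom_closed that by simp
  have \<phi>m: "\<phi> (g \<otimes> h) = \<phi> g \<otimes>\<^bsub>Q\<^esub> \<phi> h" if "g \<in> N" "h \<in> N" for g h using \<phi>.hom_mult that by simp
  have Z_iff: "g \<in> Z \<longleftrightarrow> g \<in> N \<and> \<phi> g = \<one>\<^bsub>Q\<^esub>" for g
    unfolding ker[symmetric] by (simp add: kernel_def)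
  have xN: "x \<in> N" using x(1) by (simp add: N_def)
  have \<phi>x: "\<phi> x \<noteq> \<one>\<^bsub>Q\<^esub>" "\<phi> x \<otimes>\<^bsub>Q\<^esub> \<phi> x = \<one>\<^bsub>Q\<^esub>"
    using x(2,3) xN Z_iff \<phi>m by auto
  have conj_N: "g \<otimes> h \<otimes> inv g \<in> N" if "g \<in> N" "h \<in> N" for g h using that N_closed by blast
  have conj_\<phi>: "\<phi> (g \<otimes> h \<otimes> inv g) = \<phi> (g \<otimes> k \<otimes> inv g)"
    if "g \<in> N" "h \<in> N" "k \<in> N" "\<phi> h = \<phi> k" for g h k
    using that N_closed by (simp add: \<phi>m)
  define C where "C = {g \<in> N. g \<otimes> x \<otimes> inv g = x}"
  have fin: "finite {y \<in> N. \<phi> y \<otimes>\<^bsub>Q\<^esub> \<phi> y = \<one>\<^bsub>Q\<^esub>}"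
    using finite_involutions_mod[OF planar acc dcc N gh _ xN \<phi>x] Z(2) ker by simp
  have "(\<lambda>g. g \<otimes> x \<otimes> inv g) ` N \<subseteq> {y \<in> N. \<phi> y \<otimes>\<^bsub>Q\<^esub> \<phi> y = \<one>\<^bsub>Q\<^esub>}"
  proof clarify
    fix g assume g: "g \<in> N"
    have "(g \<otimes> x \<otimes> inv g) \<otimes> (g \<otimes> x \<otimes> inv g) = g \<otimes> (x \<otimes> x) \<otimes> inv g"
      using NG[OF g] NG[OF xN] by (simp add: m_assoc) (simp flip: m_assoc)
    also have "\<dots> \<in> Z"
      using normalizerD[of g Z] g x(3) subgroup.subset[OF Z(1)] by (simp add: N_def)
    finally show "g \<otimes> x \<otimes> inv g \<in> N \<and> \<phi> (g \<otimes> x \<otimes> inv g) \<otimes>\<^bsub>Q\<^esub> \<phi> (g \<otimes> x \<otimes> inv g) = \<one>\<^bsub>Q\<^esub>"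
      using conj_N[OF g xN] Z_iff \<phi>m by simp
  qed
  then have "finite ((\<lambda>g. g \<otimes> x \<otimes> inv g) ` N)" using fin finite_subset by blast
  \<comment> \<open>Conjugating \<open>x\<close> by the infinite \<open>N\<close> gives finitely
    many values, hence an infinite fibre; translation by \<open>inv b\<close> moves it into the
    centralizer \<open>C\<close>.\<close>
  then obtain b where b: "b \<in> N" "infinite {g \<in> N. g \<otimes> x \<otimes> inv g = b \<otimes> x \<otimes> inv b}"
    using pigeonhole_infinite[of N "\<lambda>g. g \<otimes> x \<otimes> inv g"] inf unfolding N_def by blast
  have "(\<lambda>g. inv b \<otimes> g) ` {g \<in> N. g \<otimes> x \<otimes> inv g = b \<otimes> x \<otimes> inv b} \<subseteq> C"
  proof clarify
    fix g assume g: "g \<in> N" "g \<otimes> x \<otimes> inv g = b \<otimes> x \<otimes> inv b"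
    note car = NG[OF g(1)] NG[OF b(1)] NG[OF xN]
    have "(inv b \<otimes> g) \<otimes> x \<otimes> inv (inv b \<otimes> g) = inv b \<otimes> (g \<otimes> x \<otimes> inv g) \<otimes> b"
      using car by (simp add: inv_mult_group m_assoc)
    also have "\<dots> = (inv b \<otimes> b) \<otimes> x \<otimes> (inv b \<otimes> b)"
      unfolding g(2) using car by (simp only: m_assoc m_closed inv_closed)
    also have "\<dots> = x" using car by simp
    finally show "inv b \<otimes> g \<in> C" using N_closed g b by (simp add: C_def)
  qed
  moreover have "inj_on (\<lambda>g. inv b \<otimes> g) {g \<in> N. g \<otimes> x \<otimes> inv g = b \<otimes> x \<otimes> inv b}"
    using NG b(1) by (auto simp: inj_on_def)
  ultimately have infC: "infinite C" using b(2) by (meson finite_imageD finite_subset)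
  define Z' where "Z' = {g \<in> N. \<phi> g \<in> {\<one>\<^bsub>Q\<^esub>, \<phi> x}}"
  have Z': "subgroup Z' G"
    using incl_subgroup[OF N \<phi>.subgroup_preimage[OF \<phi>.H.involution_subgroup[OF \<phi>Q[OF xN] \<phi>x(2)]]]
    by (simp add: Z'_def)
  \<comment> \<open>The image of a conjugate depends only on the image of the conjugated element, so
    \<open>h\<close> may be replaced by \<open>\<one>\<close> or by \<open>x\<close>, both of which
    \<open>g\<close> centralizes.\<close>
  have C_conj: "g \<otimes> h \<otimes> inv g \<in> Z'" if "g \<in> N" "g \<otimes> x \<otimes> inv g = x" "h \<in> Z'" for g h
  proof -
    have h: "h \<in> N" "\<phi> h = \<phi> \<one> \<or> \<phi> h = \<phi> x" using that(3) \<phi>.hom_one by (auto simp: Z'_def)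
    have "\<phi> (g \<otimes> h \<otimes> inv g) = \<phi> (g \<otimes> \<one> \<otimes> inv g) \<or> \<phi> (g \<otimes> h \<otimes> inv g) = \<phi> (g \<otimes> x \<otimes> inv g)"
      using h conj_\<phi>[OF that(1) h(1)] subgroup.one_closed[OF N] xN by blast
    then have "\<phi> (g \<otimes> h \<otimes> inv g) = \<one>\<^bsub>Q\<^esub> \<or> \<phi> (g \<otimes> h \<otimes> inv g) = \<phi> x"
      using that NG \<phi>.hom_one by simp
    then show ?thesis using conj_N[OF that(1) h(1)] by (simp add: Z'_def)
  qed
  have "C \<subseteq> normalizer G Z'"
  proof
    fix g assume "g \<in> C"
    then have g: "g \<in> N" "g \<otimes> x \<otimes> inv g = x" by (auto simp: C_def)
    note car = NG[OF g(1)] NG[OF xN]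
    have "inv g \<otimes> (g \<otimes> x \<otimes> inv g) \<otimes> inv (inv g) = (inv g \<otimes> g) \<otimes> x \<otimes> (inv g \<otimes> g)"
      using car by (simp only: m_assoc m_closed inv_closed inv_inv)
    then have ig: "inv g \<otimes> x \<otimes> inv (inv g) = x" using car g(2) by simp
    show "g \<in> normalizer G Z'"
    proof (rule normalizerI[OF car(1) subgroup.subset[OF Z']])
      show "g \<otimes> h \<otimes> inv g \<in> Z'" if "h \<in> Z'" for h using C_conj[OF g that] .
      show "inv g \<otimes> h \<otimes> g \<in> Z'" if "h \<in> Z'" for h
        using C_conj[OF N_closed(2)[OF g(1)] ig that] car by simp
    qed
  qed
  then have "infinite (normalizer G Z')" using infC finite_subset by blast
  moreover have "finite Z'"
    using \<phi>.finite_preimage[of "{\<one>\<^bsub>Q\<^esub>, \<phi> x}"] ker Z(2) by (simp add: Z'_def)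
  moreover have "x \<in> Z'" using xN by (simp add: Z'_def)
  moreover have "Z \<subseteq> Z'" using Z_iff by (auto simp: Z'_def)
  ultimately show thesis using that Z' x(2) by blast
qed

section \<open>Finite subgroups of even order without involutions in the quotient\<close>

text \<open>The finite groups \<open>D y\<close>, preimages of the cyclic groups generated by the
  images of the \<open>y\<close>, cover the normalizer. If it were infinite, they would form an
  infinite family above \<open>Z\<close>, which planarity forbids.\<close>

lemma (in group) finite_normalizer_if_no_involution_mod:
  assumes planar: "planar_group G" and acc: "subgroup_acc G" and dcc: "subgroup_dcc G"
    and Z: "subgroup Z G" "finite Z" and x: "x \<in> Z" "ord x = 2"
    and sq: "\<And>y. y \<in> normalizer G Z \<Longrightarrow> y \<otimes> y \<in> Z \<Longrightarrow> y \<in> Z"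
  shows "finite (normalizer G Z)"
proof (rule ccontr)
  assume inf: "infinite (normalizer G Z)"
  define N where "N = normalizer G Z"
  define M where "M = G\<lparr>carrier := N\<rparr>"
  define Q where "Q = M Mod Z"
  define \<phi> where "\<phi> = (\<lambda>a. Z #>\<^bsub>M\<^esub> a)"
  have N: "subgroup N G" unfolding N_def by (rule normalizer_imp_subgroup[OF subgroup.subset[OF Z(1)]])
  have gh: "group_hom (G\<lparr>carrier := N\<rparr>) Q \<phi>" and ker: "kernel (G\<lparr>carrier := N\<rparr>) Q \<phi> = Z"
    using normalizer_quotient[OF Z(1)] unfolding Q_def \<phi>_def M_def N_def by blast+
  interpret \<phi>: group_hom "G\<lparr>carrier := N\<rparr>" Q \<phi> by (rule gh)
  note NG = subgroup.mem_carrier[OF N]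
  have Z_iff: "g \<in> Z \<longleftrightarrow> g \<in> N \<and> \<phi> g = \<one>\<^bsub>Q\<^esub>" for g
    unfolding ker[symmetric] by (simp add: kernel_def)
  have \<phi>Q: "\<phi> g \<in> carrier Q" if "g \<in> N" for g using \<phi>.hom_closed that by simp
  define D where "D y = {g \<in> N. \<phi> g \<in> generate Q {\<phi> y}}" for y
  have D: "subgroup (D y) G" "finite (D y)" "Z \<subseteq> D y" "y \<in> D y" if y: "y \<in> N" for y
  proof -
    have gen: "subgroup (generate Q {\<phi> y}) Q" using \<phi>Q[OF y] by (intro \<phi>.H.generate_is_subgroup) auto
    show "subgroup (D y) G" using incl_subgroup[OF N \<phi>.subgroup_preimage[OF gen]] by (simp add: D_def)
    have "finite (generate Q {\<phi> y})"
      using \<phi>.H.finite_cyclic_subgroup_order[OF \<phi>Q[OF y]] ord_image_nonzero[OF dcc N gh y] \<phi>Q[OF y]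
      by (simp add: carrier_subgroup_generated)
    then show "finite (D y)" using \<phi>.finite_preimage ker Z(2) by (simp add: D_def)
    show "Z \<subseteq> D y" using Z_iff subgroup.one_closed[OF gen] by (auto simp: D_def)
    show "y \<in> D y" using y by (simp add: D_def generate.incl)
  qed
  \<comment> \<open>Modulo \<open>Z\<close> every order is odd, so each \<open>f\<close> is a product of an element of \<open>Z\<close> and an odd-order
    power \<open>t\<close> of \<open>f\<close>; the group generated by \<open>t\<close> cannot contain the involution \<open>x\<close> of \<open>E\<close>.\<close>
  have "infinite (D ` N)"
  proof
    assume "finite (D ` N)"
    then have "finite (\<Union>(D ` N))" using D by blast
    moreover have "N \<subseteq> \<Union>(D ` N)" using D by blast
    ultimately show False using inf finite_subset unfolding N_def by blast
  qed
  then show False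
  proof (rule planar_infinite_family[OF planar acc dcc Z(1)])
    show "subgroup A G \<and> Z \<subseteq> A" if "A \<in> D ` N" for A using that D by blast
    fix E F A
    assume E: "subgroup E G" and F: "subgroup F G" and A: "A \<in> D ` N" "Z \<subseteq> E" "E \<subset> F" "F \<subseteq> A"
    obtain f where f: "f \<in> F" "f \<notin> E" using A(3) by blast
    then have fN: "f \<in> N" using A(1,4) by (auto simp: D_def)
    have fG: "f \<in> carrier G" by (rule NG[OF fN])
    obtain r where r: "ord f = 2 ^ multiplicity 2 (ord f) * r" "odd r"
      using multiplicity_decompose'[of "ord f" 2] ord_nonzero_if_dcc[OF dcc fG] by auto
    define m where "m = multiplicity 2 (ord f)"
    have ordf: "f [^] ((2::nat) ^ m * r) = \<one>" using r(1) fG pow_ord_eq_1 by (metis m_def)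
    define t where "t = f [^] ((2::nat) ^ m)"
    have tG: "t \<in> carrier G" using fG by (simp add: t_def)
    have tr: "t [^] r = \<one>" using fG ordf by (simp add: t_def nat_pow_pow)
    have pow_mem: "f [^] (k::nat) \<in> H" if "subgroup H G" "f \<in> H" for H k
      using subgroup_int_pow_closed[OF that, of "int k"] by (simp add: int_pow_int)
    have "(f [^] r) [^] ((2::nat) ^ m) \<in> Z"
      using fG ordf subgroup.one_closed[OF Z(1)] by (simp add: nat_pow_pow mult.commute)
    then have frZ: "f [^] r \<in> Z"
      using odd_order_modulo[OF N sq[folded N_def] pow_mem[OF N fN]] by blast
    have tE: "t \<notin> E"
    proof
      assume tE: "t \<in> E"
      \<comment> \<open>By Bezout \<open>f\<close> is a product of a power of \<open>t\<close> and a
        power of \<open>f [^] r\<close>. The latter lies in \<open>Z\<close>, so \<open>t\<close> in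
        \<open>E\<close> would force \<open>f\<close> into \<open>E\<close>.\<close>
      have "coprime (int (2 ^ m)) (int r)" using r(2) by simp
      then obtain u v where uv: "u * int (2 ^ m) + v * int r = 1"
        using bezout_int[of "int (2 ^ m)" "int r"] by (auto simp: coprime_iff_gcd_eq_1)
      have "f = f [^] (int (2 ^ m) * u + int r * v)"
        using uv fG by (simp add: mult.commute)
      also have "\<dots> = (f [^] int (2 ^ m)) [^] u \<otimes> (f [^] int r) [^] v"
        using fG by (simp only: int_pow_mult int_pow_pow)
      also have "\<dots> = t [^] u \<otimes> (f [^] r) [^] v" by (simp only: int_pow_int t_def)
      also have "\<dots> \<in> E"
        using E tE frZ A(2) by (blast intro: subgroup.m_closed subgroup_int_pow_closed)
      finally show False using f by blast
    qed
    show "\<exists>T. subgroup T G \<and> T \<subseteq> F \<and> \<not> T \<subseteq> E \<and> \<not> E \<subseteq> T"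
    proof (intro exI conjI)
      show "subgroup (generate G {t}) G" using tG by (intro generate_is_subgroup) auto
      show "generate G {t} \<subseteq> F"
        using generate_subgroup_incl[OF _ F, of "{t}"] pow_mem[OF F f(1)] by (simp add: t_def)
      show "\<not> generate G {t} \<subseteq> E" using tE generate.incl[of t "{t}" G] by blast
      show "\<not> E \<subseteq> generate G {t}"
      proof
        assume "E \<subseteq> generate G {t}"
        then have "x \<in> generate G {t}" using x(1) A(2) by blast
        then obtain k :: int where k: "x = t [^] k" using generate_pow[OF tG] by blast
        have "x [^] r = (t [^] int r) [^] k"
          unfolding k int_pow_int[symmetric] using tG by (simp only: int_pow_pow mult.commute)
        also have "\<dots> = \<one>" using tr by (simp add: int_pow_int)
        finally have "2 dvd r" using pow_eq_id[of x r] x subgroup.mem_carrier[OF Z(1)] by simp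
        then show False using r(2) by blast
      qed
    qed
  qed
qed

section \<open>A maximal finite subgroup with infinite normalizer\<close>

text \<open>Take \<open>Z\<close> maximal among the finite subgroups containing \<open>x\<close>
  with infinite normalizer. By \<open>extend_finite_subgroup\<close> maximality excludes involutions
  modulo \<open>Z\<close>, and then the normalizer has to be finite.\<close>

lemma (in group) planar_no_involution:
  assumes inf: "infinite (carrier G)"
    and hyps: "planar_group G" "subgroup_acc G" "subgroup_dcc G"
    and x: "x \<in> carrier G"
  shows "ord x \<noteq> 2"
proof
  assume x2: "ord x = 2"
  note x = x(1) x2
  have norm: "g \<in> normalizer G {\<one>}" if "g \<in> carrier G" for g
    using that by (intro normalizerI) auto
  have inf1: "infinite (normalizer G {\<one>})"
    by (rule infinite_super[OF subsetI[OF norm] inf])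
  have xx: "x \<otimes> x \<in> {\<one>}"
    using pow_ord_eq_1[OF x(1)] x(1) unfolding x2 by (simp add: numeral_2_eq_2)
  have x1: "x \<notin> {\<one>}" using x by auto
  \<comment> \<open>The trivial subgroup has infinite normalizer but lacks \<open>x\<close>; one
    extension by \<open>x\<close> yields the first subgroup satisfying \<open>P\<close>.\<close>
  obtain Z\<^sub>0 where Z\<^sub>0: "subgroup Z\<^sub>0 G" "finite Z\<^sub>0" "{\<one>} \<subset> Z\<^sub>0" "x \<in> Z\<^sub>0" "infinite (normalizer G Z\<^sub>0)"
    by (rule extend_finite_subgroup[OF hyps triv_subgroup _ inf1 norm[OF x(1)] x1 xx]) auto
  define P where "P Z \<longleftrightarrow> subgroup Z G \<and> finite Z \<and> x \<in> Z \<and> infinite (normalizer G Z)" for Z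
  have P: "P Z\<^sub>0" "\<And>H. P H \<Longrightarrow> subgroup H G"
    using Z\<^sub>0 by (simp_all add: P_def)
  obtain Z where "P Z" "Z\<^sub>0 \<subseteq> Z" and max: "\<And>K. P K \<Longrightarrow> Z \<subset> K \<Longrightarrow> False"
    by (rule subgroup_acc_maximal[where P = P, OF hyps(2) P(1)]) (rule P(2), assumption, rule that)
  then have Z: "subgroup Z G" "finite Z" "x \<in> Z" "infinite (normalizer G Z)"
    by (simp_all add: P_def)
  have "y \<in> Z" if y: "y \<in> normalizer G Z" "y \<otimes> y \<in> Z" for y
  proof (rule ccontr)
    assume "y \<notin> Z"
    then obtain Z' where "subgroup Z' G" "finite Z'" "Z \<subset> Z'" "y \<in> Z'" "infinite (normalizer G Z')"
      using extend_finite_subgroup[OF hyps Z(1,2,4) y(1) _ y(2)] by metis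
    then show False using max[of Z'] Z(3) unfolding P_def by blast
  qed
  then show False
    using finite_normalizer_if_no_involution_mod[OF hyps Z(1-3) x2] Z(4) by blast
qed

theorem theorem3p12:
  fixes G :: "('a, 'b) monoid_scheme"
  assumes "group G"
    and "infinite (carrier G)"
    and "planar_group G"
    and "subgroup_acc G"
    and "subgroup_dcc G"
  shows "\<forall>x \<in> carrier G. group.ord G x \<noteq> 2"
  using group.planar_no_involution[OF assms] by blast

end
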